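(* There exist a polynomial $p$ (with nonnegative coefficients) and absolute constants hidden in the $O(\cdot)$ below such that the following holds. Let $A\in\mathbb{R}^{n\times d}$ be a matrix with singular values $\sigma_1\ge\dots\ge\sigma_d>0$, let $1\le k<d$, $\Delta>0$, and assume that $A$ is $(k,\Delta)$-separated, i.e. $\sigma_k^2-\sigma_{k+1}^2\ge\Delta\sigma_1^2$, and approximately rank-$k$, i.e. $\sum_{i=1}^k\sigma_i^2\ge\frac1{10}\sum_{i=1}^d\sigma_i^2$. Let $\kappa_k=\sigma_1^2/\sigma_k^2$. Then for every $\varepsilon>0$ there is a sketch size $\ell\le k^2\cdot p(\varepsilon^{-1},\kappa_k,\Delta^{-1})$ such that the two-pass row-streaming algorithm described in the context (Frequent Directions with sketch size $\ell$ in the first pass, scores computed from the sketch in the second pass) computes estimates $\tilde T^k(i)$ and $\tilde L^k(i)$ satisfying, for every $i\in\{1,\dots,n\}$, $$|T^k(i)-\tilde T^k(i)|\le\varepsilon\|a_{(i)}\|_2^2,\qquad |L^k(i)-\tilde L^k(i)|\le\varepsilon k\,\frac{\|a_{(i)}\|_2^2}{\|A\|_F^2}.$$ The algorithm uses memory $O(d\ell)$ and has running time $O(nd\ell)$.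
   Context: Let $a_{(i)}\in\mathbb{R}^d$ be the $i$-th row of $A$ (as a column vector), $A=U\Sigma V^T$ the SVD of $A$ with $\Sigma=\mathrm{diag}(\sigma_1,\dots,\sigma_d)$, and $v^{(j)}$ the $j$-th column of $V$. The rank-$k$ leverage score and rank-$k$ projection distance of row $i$ are $$L^k(i)=\sum_{j=1}^k\frac{(a_{(i)}^Tv^{(j)})^2}{\sigma_j^2},\qquad T^k(i)=\sum_{j=k+1}^d(a_{(i)}^Tv^{(j)})^2.$$ Row-streaming model: the rows of $A$ arrive one after the other in each pass. Memory is counted in real numbers stored, and time in real arithmetic operations, where an SVD of a $p\times q$ matrix costs $O(pq\min(p,q))$. Frequent Directions with sketch size $\ell$: maintain a buffer $B\in\mathbb{R}^{2\ell\times d}$, initially zero. Insert each arriving row into a zero row of $B$. Whenever $B$ has no zero row, and once more at the end of the stream, perform a shrinking step: compute the SVD $B=QSW^T$ with singular values $s_1\ge s_2\ge\cdots$ (padded with zeros), set $\delta=s_\ell^2$, and replace $B$ by $S'W^T$, where $S'$ is diagonal with entries $\sqrt{\max(s_j^2-\delta,0)}$. The output sketch $\tilde A\in\mathbb{R}^{\ell\times d}$ consists of the first $\ell$ rows of the final $B$ (all other rows are zero, apart from the trivial case $\ell\geq d$ in which $B$ has at most $d\le\ell$ nonzero rows). Algorithm: in the first pass, compute the Frequent Directions sketch $\tilde A$. Then compute the top $k$ singular values $\tilde\sigma_1\ge\dots\ge\tilde\sigma_k$ of $\tilde A$, let $\tilde\Sigma_k=\mathrm{diag}(\tilde\sigma_1,\dots,\tilde\sigma_k)$,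 and let $\tilde V_k\in\mathbb{R}^{d\times k}$ be the matrix of corresponding right singular vectors. In the second pass, as row $a_{(i)}$ arrives, output $$\tilde L^k(i)=\|\tilde\Sigma_k^{-1}\tilde V_k^Ta_{(i)}\|_2^2,\qquad \tilde T^k(i)=a_{(i)}^T(I-\tilde V_k\tilde V_k^T)a_{(i)}.$$ *)

theory Defs
  imports Complex_Main "Jordan_Normal_Form.Matrix"
begin

section \<open>Singular value decompositions and the exact row scores\<close>

text \<open>All indices are 0-based: \<open>\<sigma>\<^sub>j\<close> of the usual notation is entry \<open>j - 1\<close>.\<close>

definition entry0 :: "real vec \<Rightarrow> nat \<Rightarrow> real" where
  "entry0 s j = (if j < dim_vec s then s $ j else 0)"

text \<open>Thin SVD of a \<open>p \<times> q\<close> matrix, with \<open>min p q\<close> singular values. Compared with the full SVD it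
  drops only columns of the orthogonal factors that meet zero padding of the diagonal factor.\<close>

definition is_svd :: "real mat \<Rightarrow> real mat \<times> real vec \<times> real mat \<Rightarrow> bool" where
  "is_svd M = (\<lambda>(Q, s, W). let r = min (dim_row M) (dim_col M) in
     Q \<in> carrier_mat (dim_row M) r \<and> s \<in> carrier_vec r \<and> W \<in> carrier_mat (dim_col M) r \<and>
     transpose_mat Q * Q = 1\<^sub>m r \<and> transpose_mat W * W = 1\<^sub>m r \<and>
     (\<forall>j<r. 0 \<le> s $ j) \<and> (\<forall>i j. i \<le> j \<longrightarrow> j < r \<longrightarrow> s $ j \<le> s $ i) \<and>
     M = Q * mat_diag r (\<lambda>j. s $ j) * transpose_mat W)"

definition sq_norm2 :: "real vec \<Rightarrow> real" where
  "sq_norm2 v = v \<bullet> v"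

definition sq_frobenius :: "real mat \<Rightarrow> real" where
  "sq_frobenius A = (\<Sum>i<dim_row A. \<Sum>j<dim_col A. (A $$ (i, j))\<^sup>2)"

definition leverage_score :: "nat \<Rightarrow> real vec \<Rightarrow> real mat \<Rightarrow> real vec \<Rightarrow> real" where
  "leverage_score k \<sigma> V a = (\<Sum>j<k. (a \<bullet> col V j)\<^sup>2 / (entry0 \<sigma> j)\<^sup>2)"

definition projection_distance :: "nat \<Rightarrow> real mat \<Rightarrow> real vec \<Rightarrow> real" where
  "projection_distance k V a = (\<Sum>j = k..<dim_vec a. (a \<bullet> col V j)\<^sup>2)"

definition separated :: "nat \<Rightarrow> real \<Rightarrow> real vec \<Rightarrow> bool" where
  "separated k \<Delta> \<sigma> \<longleftrightarrow> (entry0 \<sigma> (k - 1))\<^sup>2 - (entry0 \<sigma> k)\<^sup>2 \<ge> \<Delta> * (entry0 \<sigma> 0)\<^sup>2"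

definition approx_rank :: "nat \<Rightarrow> nat \<Rightarrow> real vec \<Rightarrow> bool" where
  "approx_rank k d \<sigma> \<longleftrightarrow> (\<Sum>j<k. (entry0 \<sigma> j)\<^sup>2) \<ge> 1 / 10 * (\<Sum>j<d. (entry0 \<sigma> j)\<^sup>2)"

definition cond_number :: "nat \<Rightarrow> real vec \<Rightarrow> real" where
  "cond_number k \<sigma> = (entry0 \<sigma> 0)\<^sup>2 / (entry0 \<sigma> (k - 1))\<^sup>2"

text \<open>Trivariate polynomial functions of degree at most \<open>N\<close> in each variable.\<close>

definition poly3 :: "nat \<Rightarrow> (nat \<Rightarrow> nat \<Rightarrow> nat \<Rightarrow> real) \<Rightarrow> real \<Rightarrow> real \<Rightarrow> real \<Rightarrow> real" where
  "poly3 N p x y z = (\<Sum>a\<le>N. \<Sum>b\<le>N. \<Sum>c\<le>N. p a b c * x ^ a * y ^ b * z ^ c)"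


section \<open>Computations with time and memory\<close>

class storable =
  fixes reals_stored :: "'a \<Rightarrow> nat"

instantiation real :: storable
begin
definition reals_stored_real :: "real \<Rightarrow> nat" where "reals_stored_real x = 1"
instance ..
end

text \<open>Row indices are not real numbers, so they are not charged.\<close>

instantiation option :: (type) storable
begin
definition reals_stored_option :: "'a option \<Rightarrow> nat" where "reals_stored_option x = 0"
instance ..
end

instantiation vec :: (type) storable
begin
definition reals_stored_vec :: "'a vec \<Rightarrow> nat" where "reals_stored_vec v = dim_vec v"
instance ..
end

instantiation mat :: (type) storable
begin
definition reals_stored_mat :: "'a mat \<Rightarrow> nat" where
  "reals_stored_mat A = dim_row A * dim_col A"
instance ..
end

instantiation prod :: (storable, storable) storable
begin
definition reals_stored_prod :: "'a \<times> 'b \<Rightarrow> nat" where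
  "reals_stored_prod x = reals_stored (fst x) + reals_stored (snd x)"
instance ..
end

text \<open>\<open>mem\<close> is the peak number of real numbers stored by a computation, including its result but
  excluding its arguments; these are charged by the caller that has them in scope.\<close>

datatype 'a comp = Comp (res: 'a) (time: nat) (mem: nat)

text \<open>In \<open>bind_comp m f\<close> the result of \<open>m\<close> stays in memory during the whole of \<open>f\<close>.\<close>

definition bind_comp :: "'a::storable comp \<Rightarrow> ('a \<Rightarrow> 'b comp) \<Rightarrow> 'b comp" where
  "bind_comp m f = (let c = f (res m) in
     Comp (res c) (time m + time c) (max (mem m) (reals_stored (res m) + mem c)))"

lemma res_bind_comp: "res (bind_comp m f) = res (f (res m))"
  by (simp add: bind_comp_def Let_def)

syntax
  "_let_comp" :: "pttrn \<Rightarrow> 'a comp \<Rightarrow> 'b comp \<Rightarrow> 'b comp"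
    ("(let\<^sub>c _ \<leftarrow> _ in//_)" [0, 51, 10] 10)
translations
  "let\<^sub>c x \<leftarrow> m in c" \<rightleftharpoons> "CONST bind_comp m (\<lambda>x. c)"

text \<open>Returning data that is already in scope.\<close>

definition return_comp :: "'a \<Rightarrow> 'a comp" where
  "return_comp x = Comp x 0 0"

text \<open>The stream is accessible only through the following two combinators: one pass, row by row. An
  arriving row is charged \<open>d\<close> time units for reading and \<open>d\<close> memory units while it is processed.
  \<open>stream_fold\<close> keeps a state between rows; \<open>stream_emit\<close> keeps nothing and writes its results to
  an output stream, which takes no memory.\<close>

fun stream_fold :: "(real vec \<Rightarrow> 's::storable \<Rightarrow> 's comp) \<Rightarrow> real vec list \<Rightarrow> 's \<Rightarrow> 's comp" where
  "stream_fold f [] s = Comp s 0 (reals_stored s)"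
| "stream_fold f (a # as) s =
    (let c = f a s; c' = stream_fold f as (res c) in
     Comp (res c') (reals_stored a + time c + time c')
       (max (reals_stored s + reals_stored a + mem c) (mem c')))"

fun stream_emit :: "(real vec \<Rightarrow> 'o comp) \<Rightarrow> real vec list \<Rightarrow> 'o list comp" where
  "stream_emit f [] = Comp [] 0 0"
| "stream_emit f (a # as) =
    (let c = f a; c' = stream_emit f as in
     Comp (res c # res c') (reals_stored a + time c + time c')
       (max (reals_stored a + mem c) (mem c')))"


subsection \<open>Primitive operations\<close>

text \<open>Moves and comparisons of real numbers are charged one time unit as well, so the time is at
  least the number of real arithmetic operations. In the first three operations, \<open>u\<close> is the
  number of operations used for each computed entry.\<close>

definition scalar_c :: "nat \<Rightarrow> real \<Rightarrow> real comp" where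
  "scalar_c u x = Comp x u 1"

definition vec_c :: "nat \<Rightarrow> nat \<Rightarrow> (nat \<Rightarrow> real) \<Rightarrow> real vec comp" where
  "vec_c u n f = Comp (vec n f) (u * n) n"

definition mat_c :: "nat \<Rightarrow> nat \<Rightarrow> nat \<Rightarrow> (nat \<times> nat \<Rightarrow> real) \<Rightarrow> real mat comp" where
  "mat_c u m n f = Comp (mat m n f) (u * m * n) (m * n)"

definition transpose_c :: "real mat \<Rightarrow> real mat comp" where
  "transpose_c A = Comp (transpose_mat A) (dim_row A * dim_col A) (dim_row A * dim_col A)"

definition mult_c :: "real mat \<Rightarrow> real mat \<Rightarrow> real mat comp" where
  "mult_c A B = Comp (A * B) (2 * dim_row A * dim_col A * dim_col B) (dim_row A * dim_col B)"

definition mult_vec_c :: "real mat \<Rightarrow> real vec \<Rightarrow> real vec comp" where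
  "mult_vec_c A v = Comp (A *\<^sub>v v) (2 * dim_row A * dim_col A) (dim_row A)"

definition minus_vec_c :: "real vec \<Rightarrow> real vec \<Rightarrow> real vec comp" where
  "minus_vec_c v w = Comp (v - w) (dim_vec v) (dim_vec v)"

definition dot_c :: "real vec \<Rightarrow> real vec \<Rightarrow> real comp" where
  "dot_c v w = Comp (v \<bullet> w) (2 * dim_vec v) 1"

text \<open>The first zero row, found by comparing all entries with zero.\<close>

definition find_zero_row_c :: "real mat \<Rightarrow> nat option comp" where
  "find_zero_row_c B = Comp
     (if \<exists>i<dim_row B. row B i = 0\<^sub>v (dim_col B)
      then Some (LEAST i. i < dim_row B \<and> row B i = 0\<^sub>v (dim_col B)) else None)
     (dim_row B * dim_col B) 0"

text \<open>The SVD is a basic operation of the model. Singular vectors are not unique, so it enters as an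
  arbitrary correct subroutine together with its cost on \<open>p \<times> q\<close> inputs; \<open>svd_work\<close> is scratch
  memory in addition to the input and the three output factors.\<close>

record svd_routine =
  svd :: "real mat \<Rightarrow> real mat \<times> real vec \<times> real mat"
  svd_time :: "nat \<Rightarrow> nat \<Rightarrow> nat"
  svd_work :: "nat \<Rightarrow> nat \<Rightarrow> nat"

definition valid_svd_routine :: "real \<Rightarrow> svd_routine \<Rightarrow> bool" where
  "valid_svd_routine c R \<longleftrightarrow> (\<forall>M. is_svd M (svd R M)) \<and>
     (\<forall>p q. real (svd_time R p q) \<le> c * real p * real q * real (min p q)) \<and>
     (\<forall>p q. real (svd_work R p q) \<le> c * real p * real q)"

definition svd_c :: "svd_routine \<Rightarrow> real mat \<Rightarrow> (real mat \<times> real vec \<times> real mat) comp" where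
  "svd_c R M = Comp (svd R M) (svd_time R (dim_row M) (dim_col M))
     (reals_stored (svd R M) + svd_work R (dim_row M) (dim_col M))"


section \<open>First pass: Frequent Directions\<close>

text \<open>The four operations for each entry of \<open>t\<close> are squaring, subtraction, maximum and square root.\<close>

definition shrink :: "svd_routine \<Rightarrow> nat \<Rightarrow> real mat \<Rightarrow> real mat comp" where
  "shrink R l B =
    (let\<^sub>c (Q, s, W) \<leftarrow> svd_c R B in
     let\<^sub>c \<delta> \<leftarrow> scalar_c 1 ((entry0 s (l - 1))\<^sup>2) in
     let\<^sub>c t \<leftarrow> vec_c 4 (dim_vec s) (\<lambda>j. sqrt (max ((s $ j)\<^sup>2 - \<delta>) 0)) in
     let\<^sub>c S' \<leftarrow> mat_c 1 (dim_row B) (dim_vec s) (\<lambda>(i, j). if i = j then t $ j else 0) in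
     let\<^sub>c Wt \<leftarrow> transpose_c W in
     mult_c S' Wt)"

definition insert_row :: "real mat \<Rightarrow> nat \<Rightarrow> real vec \<Rightarrow> real mat comp" where
  "insert_row B r a =
     mat_c 1 (dim_row B) (dim_col B) (\<lambda>(i, j). if i = r then a $ j else B $$ (i, j))"

text \<open>For \<open>l \<ge> 1\<close> the buffer has a zero row at the start of every update: it is initially zero, and
  shrinking turns some row into zero. Hence \<open>the z\<close> is well-defined.\<close>

definition fd_update :: "svd_routine \<Rightarrow> nat \<Rightarrow> real vec \<Rightarrow> real mat \<Rightarrow> real mat comp" where
  "fd_update R l a B =
    (let\<^sub>c z \<leftarrow> find_zero_row_c B in
     let\<^sub>c B' \<leftarrow> insert_row B (the z) a in
     let\<^sub>c z' \<leftarrow> find_zero_row_c B' in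
     (if z' = None then shrink R l B' else return_comp B'))"

definition fd_sketch :: "svd_routine \<Rightarrow> nat \<Rightarrow> nat \<Rightarrow> real vec list \<Rightarrow> real mat comp" where
  "fd_sketch R l d as =
    (let\<^sub>c B0 \<leftarrow> mat_c 1 (2 * l) d (\<lambda>_. 0) in
     let\<^sub>c B1 \<leftarrow> stream_fold (fd_update R l) as B0 in
     let\<^sub>c B2 \<leftarrow> shrink R l B1 in
     mat_c 1 l d (\<lambda>(i, j). B2 $$ (i, j)))"

text \<open>Top \<open>k\<close> singular values and right singular vectors. If the sketch has fewer than \<open>k\<close> singular
  values, the list of values is padded with zeros.\<close>

definition top_svd :: "svd_routine \<Rightarrow> nat \<Rightarrow> real mat \<Rightarrow> (real vec \<times> real mat) comp" where
  "top_svd R k M =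
    (let\<^sub>c (Q, s, W) \<leftarrow> svd_c R M in
     let\<^sub>c \<sigma>k \<leftarrow> vec_c 1 k (entry0 s) in
     let\<^sub>c Vk \<leftarrow> mat_c 1 (dim_row W) k (\<lambda>(i, j). W $$ (i, j)) in
     return_comp (\<sigma>k, Vk))"

definition first_pass ::
  "svd_routine \<Rightarrow> nat \<Rightarrow> nat \<Rightarrow> nat \<Rightarrow> real vec list \<Rightarrow> (real vec \<times> real mat) comp" where
  "first_pass R l k d as =
    (let\<^sub>c At \<leftarrow> fd_sketch R l d as in
     top_svd R k At)"


section \<open>Second pass: scores from the sketch\<close>

text \<open>The matrix \<open>I - V\<^sub>k V\<^sub>k\<^sup>T\<close> has \<open>d\<^sup>2\<close> entries and is therefore never formed; see the lemma below
  for the values that are computed.\<close>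

definition row_scores :: "real vec \<Rightarrow> real mat \<Rightarrow> real vec \<Rightarrow> (real \<times> real) comp" where
  "row_scores \<sigma>k Vk a =
    (let\<^sub>c Vt \<leftarrow> transpose_c Vk in
     let\<^sub>c y \<leftarrow> mult_vec_c Vt a in
     let\<^sub>c Si \<leftarrow> mat_c 1 (dim_vec \<sigma>k) (dim_vec \<sigma>k) (\<lambda>(i, j). if i = j then 1 / \<sigma>k $ j else 0) in
     let\<^sub>c x \<leftarrow> mult_vec_c Si y in
     let\<^sub>c L \<leftarrow> dot_c x x in
     let\<^sub>c w \<leftarrow> mult_vec_c Vk y in
     let\<^sub>c u \<leftarrow> minus_vec_c a w in
     let\<^sub>c T \<leftarrow> dot_c a u in
     return_comp (T, L))"

lemma res_row_scores:
  assumes "\<sigma>k \<in> carrier_vec k" "Vk \<in> carrier_mat d k" "a \<in> carrier_vec d"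
  shows "res (row_scores \<sigma>k Vk a) =
    (a \<bullet> ((1\<^sub>m d - Vk * transpose_mat Vk) *\<^sub>v a),
     sq_norm2 ((mat_diag k (\<lambda>j. 1 / \<sigma>k $ j) * transpose_mat Vk) *\<^sub>v a))"
proof -
  have Vt: "transpose_mat Vk \<in> carrier_mat k d" using assms by simp
  have "(1\<^sub>m d - Vk * transpose_mat Vk) *\<^sub>v a = 1\<^sub>m d *\<^sub>v a - (Vk * transpose_mat Vk) *\<^sub>v a"
    by (rule minus_mult_distrib_mat_vec[where nr = d and nc = d]) (use assms Vt in auto)
  also have "\<dots> = a - Vk *\<^sub>v (transpose_mat Vk *\<^sub>v a)"
    using assms Vt assoc_mult_mat_vec[OF assms(2) Vt assms(3)] by simp
  finally have 1: "(1\<^sub>m d - Vk * transpose_mat Vk) *\<^sub>v a = a - Vk *\<^sub>v (transpose_mat Vk *\<^sub>v a)" .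
  have 2: "(mat_diag k (\<lambda>j. 1 / \<sigma>k $ j) * transpose_mat Vk) *\<^sub>v a =
      mat_diag k (\<lambda>j. 1 / \<sigma>k $ j) *\<^sub>v (transpose_mat Vk *\<^sub>v a)"
    by (rule assoc_mult_mat_vec[OF mat_diag_dim Vt assms(3)])
  have 3: "mat k k (\<lambda>(i, j). if i = j then 1 / \<sigma>k $ j else 0) = mat_diag k (\<lambda>j. 1 / \<sigma>k $ j)"
    by (simp add: mat_diag_def)
  have 4: "dim_vec \<sigma>k = k" using assms by simp
  show ?thesis
    unfolding 1 2 unfolding row_scores_def transpose_c_def mult_vec_c_def mat_c_def dot_c_def
      minus_vec_c_def return_comp_def sq_norm2_def res_bind_comp comp.sel 4 3 ..
qed

definition two_pass :: "svd_routine \<Rightarrow> nat \<Rightarrow> nat \<Rightarrow> nat \<Rightarrow> real vec list \<Rightarrow> (real \<times> real) list comp" where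
  "two_pass R l k d as =
    (let\<^sub>c (\<sigma>k, Vk) \<leftarrow> first_pass R l k d as in
     stream_emit (row_scores \<sigma>k Vk) as)"

end

theory Submission
  imports Defs "Jordan_Normal_Form.Determinant"
begin

text \<open>Write \<open>M = A\<^sup>T A\<close> with eigenvalues \<open>\<lambda>\<^sub>i\<close> and eigenvectors \<open>v\<^sub>i\<close>, and \<open>N\<close>, \<open>\<mu>\<^sub>j\<close>, \<open>w\<^sub>j\<close> for the
  sketch. A shrinking step with threshold \<open>\<delta>\<close> lowers the quadratic form by at most \<open>\<delta>\<close> and the squared
  Frobenius norm by at least \<open>l \<delta>\<close>. With \<open>\<phi>\<close> the squared Frobenius norm of \<open>A\<close>, this gives
  \<open>0 \<le> M - N \<le> \<phi> / l\<close>; as the trace of \<open>M - N\<close> is at most \<open>\<phi>\<close>, the squared Frobenius norm of \<open>M - N\<close>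
  is at most \<open>\<phi>\<^sup>2 / l\<close>.

  Both scores are quadratic forms \<open>f(M)\<close> of spectral functions. The matrix of \<open>f(M) - g(N)\<close> in the bases
  \<open>v\<close> and \<open>w\<close> has the entries \<open>(f\<^sub>i - g\<^sub>j) \<langle>v\<^sub>i, w\<^sub>j\<rangle>\<close>, so a bound \<open>\<bar>f\<^sub>i - g\<^sub>j\<bar> \<le> K \<bar>\<lambda>\<^sub>i - \<mu>\<^sub>j\<bar>\<close> on the two spectra
  bounds its Frobenius norm by \<open>K \<phi> / sqrt l\<close>. Weyl's inequality and the spectral gap give such a \<open>K\<close>, and
  \<open>\<phi> \<le> 10 k \<lambda>\<^sub>0\<close> shows that \<open>l\<close> of order \<open>k\<^sup>2\<close> suffices.\<close>

section \<open>Perturbation of spectral functions\<close>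

text \<open>Vectors are functions of which only the values below \<open>d\<close> count. Rows,
  columns and linear combinations of them then carry no dimension conditions.\<close>

definition ip :: "nat \<Rightarrow> (nat \<Rightarrow> real) \<Rightarrow> (nat \<Rightarrow> real) \<Rightarrow> real" where
  "ip d x y = (\<Sum>t<d. x t * y t)"

lemma ip_commute: "ip d x y = ip d y x"
  by (simp add: ip_def mult.commute)

lemma ip_diff_left: "ip d (\<lambda>t. x t - y t) z = ip d x z - ip d y z"
  by (simp add: ip_def sum_subtractf left_diff_distrib)

lemma ip_diff_right: "ip d z (\<lambda>t. x t - y t) = ip d z x - ip d z y"
  by (simp add: ip_def sum_subtractf right_diff_distrib)

lemma ip_scale_left: "ip d (\<lambda>t. c * x t) z = c * ip d x z"
  by (simp add: ip_def sum_distrib_left mult.assoc)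

lemma ip_scale_right: "ip d z (\<lambda>t. c * x t) = c * ip d z x"
  by (simp add: ip_def sum_distrib_left ac_simps)

lemma ip_sum_left: "ip d (\<lambda>t. \<Sum>i\<in>I. f i t) z = (\<Sum>i\<in>I. ip d (f i) z)"
  unfolding ip_def sum_distrib_right by (rule sum.swap)

lemma ip_sum_right: "ip d z (\<lambda>t. \<Sum>i\<in>I. f i t) = (\<Sum>i\<in>I. ip d z (f i))"
  unfolding ip_def sum_distrib_left by (rule sum.swap)

lemmas ip_simps = ip_diff_left ip_diff_right ip_scale_left ip_scale_right ip_sum_left ip_sum_right

lemma ip_nonneg: "0 \<le> ip d x x"
  by (simp add: ip_def sum_nonneg)

text \<open>The sum of the squares of \<open>Y * x i - Z * y i\<close> expands to
  \<open>Y * (Y * X - Z^2)\<close>. A positive \<open>Y\<close> can be cancelled, and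
  \<open>Y = 0\<close> forces every \<open>y i\<close> to vanish.\<close>

lemma sum_Cauchy_Schwarz:
  fixes x y :: "'a \<Rightarrow> real"
  assumes "finite I"
  shows "(\<Sum>i\<in>I. x i * y i)\<^sup>2 \<le> (\<Sum>i\<in>I. (x i)\<^sup>2) * (\<Sum>i\<in>I. (y i)\<^sup>2)"
proof (cases "(\<Sum>i\<in>I. (y i)\<^sup>2) = 0")
  case True
  then have "\<forall>i\<in>I. y i = 0"
    using assms by (subst (asm) sum_nonneg_eq_0_iff) auto
  then show ?thesis by simp
next
  case False
  define X Y Z where "X = (\<Sum>i\<in>I. (x i)\<^sup>2)" and "Y = (\<Sum>i\<in>I. (y i)\<^sup>2)" and "Z = (\<Sum>i\<in>I. x i * y i)"
  have Y: "0 < Y"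
    using False sum_nonneg[of I "\<lambda>i. (y i)\<^sup>2"] by (simp add: Y_def)
  have "0 \<le> (\<Sum>i\<in>I. (Y * x i - Z * y i)\<^sup>2)"
    by (rule sum_nonneg) simp
  also have "\<dots> = (\<Sum>i\<in>I. Y\<^sup>2 * (x i)\<^sup>2 - (2 * Y * Z) * (x i * y i) + Z\<^sup>2 * (y i)\<^sup>2)"
    by (rule sum.cong) (auto simp: power2_eq_square algebra_simps)
  also have "\<dots> = Y\<^sup>2 * X - (2 * Y * Z) * Z + Z\<^sup>2 * Y"
    by (simp only: sum.distrib sum_subtractf sum_distrib_left[symmetric] X_def Y_def Z_def)
  also have "\<dots> = Y * (Y * X - Z\<^sup>2)"
    by (simp add: power2_eq_square algebra_simps)
  finally have "0 \<le> Y * X - Z\<^sup>2"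
    using Y by (simp add: zero_le_mult_iff)
  then show ?thesis by (simp add: X_def Y_def Z_def mult.commute)
qed

lemma ip_Cauchy_Schwarz: "(ip d x y)\<^sup>2 \<le> ip d x x * ip d y y"
  using sum_Cauchy_Schwarz[of "{..<d}" x y] by (simp add: ip_def power2_eq_square)

section \<open>Orthonormal families and Bessel's inequality\<close>

definition orthonormal :: "nat \<Rightarrow> nat \<Rightarrow> (nat \<Rightarrow> nat \<Rightarrow> real) \<Rightarrow> bool" where
  "orthonormal d r w \<longleftrightarrow> (\<forall>i<r. \<forall>j<r. ip d (w i) (w j) = (if i = j then 1 else 0))"

lemma orthonormal_mono: "orthonormal d r w \<Longrightarrow> m \<le> r \<Longrightarrow> orthonormal d m w"
  by (simp add: orthonormal_def)

lemma orthonormal_combination: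
  assumes "orthonormal d r w" "j < r"
  shows "ip d (w j) (\<lambda>t. \<Sum>i<r. z i * w i t) = z j"
proof -
  have "ip d (w j) (\<lambda>t. \<Sum>i<r. z i * w i t) = (\<Sum>i<r. z i * ip d (w j) (w i))"
    by (simp add: ip_simps)
  also have "\<dots> = (\<Sum>i<r. if i = j then z i else 0)"
    by (rule sum.cong) (use assms in \<open>auto simp: orthonormal_def\<close>)
  finally show ?thesis using assms by simp
qed

lemma orthonormal_combination_norm:
  assumes "orthonormal d r w"
  shows "ip d (\<lambda>t. \<Sum>i<r. z i * w i t) (\<lambda>t. \<Sum>i<r. z i * w i t) = (\<Sum>i<r. (z i)\<^sup>2)"
proof -
  have "ip d (\<lambda>t. \<Sum>i<r. z i * w i t) (\<lambda>t. \<Sum>i<r. z i * w i t) =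
      (\<Sum>j<r. z j * ip d (w j) (\<lambda>t. \<Sum>i<r. z i * w i t))"
    by (simp only: ip_sum_left ip_scale_left)
  also have "\<dots> = (\<Sum>j<r. (z j)\<^sup>2)"
    by (rule sum.cong) (use assms in \<open>auto simp: orthonormal_combination power2_eq_square\<close>)
  finally show ?thesis .
qed

text \<open>The coefficients stay arbitrary because of two uses: the Fourier coefficients of
  \<open>x\<close> give Bessel's inequality, and weighted Fourier coefficients give the norm of a
  \<open>basis_image\<close>.\<close>

lemma norm_diff_combination:
  assumes "orthonormal d r w"
  shows "ip d (\<lambda>t. x t - (\<Sum>j<r. b j * w j t)) (\<lambda>t. x t - (\<Sum>j<r. b j * w j t)) =
    ip d x x - 2 * (\<Sum>j<r. b j * ip d x (w j)) + (\<Sum>j<r. (b j)\<^sup>2)"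
proof -
  have "ip d (\<lambda>t. \<Sum>j<r. b j * w j t) x = (\<Sum>j<r. b j * ip d x (w j))"
    by (simp add: ip_simps ip_commute)
  moreover have "ip d x (\<lambda>t. \<Sum>j<r. b j * w j t) = (\<Sum>j<r. b j * ip d x (w j))"
    by (simp add: ip_simps)
  ultimately show ?thesis
    by (simp only: ip_diff_left ip_diff_right orthonormal_combination_norm[OF assms])
qed

lemma Bessel:
  assumes "orthonormal d r w"
  shows "(\<Sum>j<r. (ip d x (w j))\<^sup>2) \<le> ip d x x"
  \<comment> \<open>With the Fourier coefficients the mixed term is twice the quadratic one, so the
    squared norm of the remainder is exactly the gap in Bessel's inequality.\<close>
  using ip_nonneg[of d "\<lambda>t. x t - (\<Sum>j<r. ip d x (w j) * w j t)"]
  unfolding norm_diff_combination[OF assms] by (simp add: power2_eq_square)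

section \<open>Comparison of the eigenvalues of two quadratic forms\<close>

lemma underdetermined_system:
  fixes C :: "nat \<Rightarrow> nat \<Rightarrow> real"
  shows "\<exists>z. (\<exists>i\<le>m. z i \<noteq> 0) \<and> (\<forall>j<m. (\<Sum>i\<le>m. C j i * z i) = 0)"
proof -
  \<comment> \<open>A zero row completes the \<open>m\<close> equations in \<open>m + 1\<close>
    unknowns to a square system. Its determinant vanishes, which yields a nonzero kernel
    vector.\<close>
  define B where "B = mat\<^sub>r (Suc m) (Suc m) (\<lambda>j. if j = m then 0\<^sub>v (Suc m) else vec (Suc m) (C j))"
  have B: "B \<in> carrier_mat (Suc m) (Suc m)" by (simp add: B_def)
  have "det B = 0" unfolding B_def by (rule det_row_0) auto
  then obtain v where v: "v \<in> carrier_vec (Suc m)" "v \<noteq> 0\<^sub>v (Suc m)" "B *\<^sub>v v = 0\<^sub>v (Suc m)"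
    using det_0_iff_vec_prod_zero_field[OF B] by auto
  have "\<exists>i\<le>m. v $ i \<noteq> 0"
    using v(1,2) by (metis carrier_vecD eq_vecI index_zero_vec(1) index_zero_vec(2) less_Suc_eq_le)
  moreover have "(\<Sum>i\<le>m. C j i * v $ i) = 0" if "j < m" for j
  proof -
    have "(\<Sum>i\<le>m. C j i * v $ i) = (B *\<^sub>v v) $ j"
      using v(1) that by (simp add: B_def scalar_prod_def atLeast0LessThan lessThan_Suc_atMost)
    then show ?thesis using v(3) that by simp
  qed
  ultimately show ?thesis by (intro exI[of _ "\<lambda>i. v $ i"]) auto
qed

text \<open>Courant-Fischer argument: by dimension the span of \<open>u 0, ..., u m\<close> contains
  a nonzero \<open>x\<close> orthogonal to \<open>w 0, ..., w (m - 1)\<close>. At \<open>x\<close>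
  the form of \<alpha> is at least \<open>\<alpha> m\<close> and that of \<beta> at most
  \<open>\<beta> m\<close> times the squared norm. The two families are interchangeable, so with
  \<open>e = 0\<close> the lemma also bounds sketch eigenvalues by the true ones.\<close>

lemma Weyl_inequality:
  assumes u: "orthonormal d N u" and w: "orthonormal d r w" and m: "m < N" "m < r"
    and \<alpha>: "\<And>i. i \<le> m \<Longrightarrow> \<alpha> m \<le> \<alpha> i" "\<And>i. 0 \<le> \<alpha> i"
    and \<beta>: "\<And>j. m \<le> j \<Longrightarrow> j < r \<Longrightarrow> \<beta> j \<le> \<beta> m" "0 \<le> \<beta> m"
    and le: "\<And>x. (\<Sum>i<N. \<alpha> i * (ip d x (u i))\<^sup>2) \<le>
                  (\<Sum>j<r. \<beta> j * (ip d x (w j))\<^sup>2) + e * ip d x x"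
  shows "\<alpha> m \<le> \<beta> m + e"
proof -
  obtain z where z: "\<exists>i\<le>m. z i \<noteq> 0" "\<forall>j<m. (\<Sum>i\<le>m. ip d (u i) (w j) * z i) = 0"
    using underdetermined_system[of m "\<lambda>j i. ip d (u i) (w j)"] by auto
  define x where "x = (\<lambda>t. \<Sum>i<Suc m. z i * u i t)"
  have um: "orthonormal d (Suc m) u" using u m by (auto intro: orthonormal_mono)
  have xx: "ip d x x = (\<Sum>i<Suc m. (z i)\<^sup>2)"
    unfolding x_def by (rule orthonormal_combination_norm[OF um])
  have pos: "0 < ip d x x"
  proof -
    obtain i where i: "i \<le> m" "z i \<noteq> 0" using z by auto
    then have "0 < (z i)\<^sup>2" by simp
    also have "\<dots> \<le> (\<Sum>i<Suc m. (z i)\<^sup>2)" using i by (intro member_le_sum) auto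
    finally show ?thesis using xx by simp
  qed
  have xu: "ip d x (u i) = z i" if "i \<le> m" for i
    unfolding x_def ip_commute[of _ _ "u i"]
    by (rule orthonormal_combination[OF um]) (use that in simp)
  have xw: "ip d x (w j) = 0" if "j < m" for j
    using z(2) that by (simp add: x_def ip_simps lessThan_Suc_atMost mult.commute)
  have "\<alpha> m * ip d x x = (\<Sum>i<Suc m. \<alpha> m * (ip d x (u i))\<^sup>2)"
    unfolding xx sum_distrib_left by (rule sum.cong) (auto simp: xu)
  also have "\<dots> \<le> (\<Sum>i<Suc m. \<alpha> i * (ip d x (u i))\<^sup>2)"
    by (rule sum_mono) (use \<alpha>(1) in \<open>auto intro!: mult_right_mono\<close>)
  also have "\<dots> \<le> (\<Sum>i<N. \<alpha> i * (ip d x (u i))\<^sup>2)"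
    by (rule sum_mono2) (use m \<alpha>(2) in auto)
  also have "\<dots> \<le> (\<Sum>j<r. \<beta> j * (ip d x (w j))\<^sup>2) + e * ip d x x" by (rule le)
  also have "(\<Sum>j<r. \<beta> j * (ip d x (w j))\<^sup>2) \<le> (\<Sum>j<r. \<beta> m * (ip d x (w j))\<^sup>2)"
  proof (rule sum_mono)
    fix j assume "j \<in> {..<r}"
    then show "\<beta> j * (ip d x (w j))\<^sup>2 \<le> \<beta> m * (ip d x (w j))\<^sup>2"
      using xw[of j] \<beta>(1)[of j] by (cases "j < m") (auto intro: mult_right_mono)
  qed
  also have "\<dots> \<le> \<beta> m * ip d x x"
    unfolding sum_distrib_left[symmetric] using Bessel[OF w] \<beta>(2) by (intro mult_left_mono) auto
  finally have "\<alpha> m * ip d x x \<le> (\<beta> m + e) * ip d x x" by (simp add: distrib_right)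
  then show ?thesis using pos by simp
qed

text \<open>\<open>basis_image v w f g i\<close> is the image of \<open>v\<^sub>i\<close> under the difference of the
  operators with eigenvalues \<open>f\<close> on \<open>v\<close> and \<open>g\<close> on \<open>w\<close>.\<close>

definition basis_image ::
  "nat \<Rightarrow> nat \<Rightarrow> (nat \<Rightarrow> nat \<Rightarrow> real) \<Rightarrow> (nat \<Rightarrow> nat \<Rightarrow> real) \<Rightarrow> (nat \<Rightarrow> real) \<Rightarrow> (nat \<Rightarrow> real) \<Rightarrow>
   nat \<Rightarrow> nat \<Rightarrow> real" where
  "basis_image d r v w f g i = (\<lambda>t. f i * v i t - (\<Sum>j<r. (g j * ip d (v i) (w j)) * w j t))"

text \<open>The vectors \<open>w j\<close> may fail to span. The last term belongs to the part of
  \<open>v i\<close> outside their span; the second operator is zero there, so the weight is the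
  full \<open>(f i)^2\<close>.\<close>

lemma basis_image_norm:
  assumes "orthonormal d N v" "orthonormal d r w" "i < N"
  shows "ip d (basis_image d r v w f g i) (basis_image d r v w f g i) =
    (\<Sum>j<r. (f i - g j)\<^sup>2 * (ip d (v i) (w j))\<^sup>2) + (f i)\<^sup>2 * (1 - (\<Sum>j<r. (ip d (v i) (w j))\<^sup>2))"
proof -
  have "ip d (v i) (v i) = 1" using assms by (simp add: orthonormal_def)
  then have "ip d (basis_image d r v w f g i) (basis_image d r v w f g i) =
      (f i)\<^sup>2 - 2 * (\<Sum>j<r. f i * g j * (ip d (v i) (w j))\<^sup>2) + (\<Sum>j<r. (g j)\<^sup>2 * (ip d (v i) (w j))\<^sup>2)"
    unfolding basis_image_def norm_diff_combination[OF assms(2)]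
    by (simp add: ip_simps power2_eq_square ac_simps)
  also have "\<dots> = (\<Sum>j<r. (f i - g j)\<^sup>2 * (ip d (v i) (w j))\<^sup>2)
      + (f i)\<^sup>2 * (1 - (\<Sum>j<r. (ip d (v i) (w j))\<^sup>2))"
    by (simp add: power2_diff algebra_simps sum.distrib sum_subtractf sum_distrib_left)
  finally show ?thesis .
qed

text \<open>Both norms are expanded by \<open>basis_image_norm\<close> and compared term by term.
  \<open>lip0\<close> is the Lipschitz condition against the eigenvalue 0 that the second operators
  have on the complement of the span of \<open>w\<close>.\<close>

lemma basis_image_Lipschitz:
  assumes v: "orthonormal d N v" and w: "orthonormal d r w" and i: "i < N"
    and lip: "\<And>j. j < r \<Longrightarrow> \<bar>f i - g j\<bar> \<le> K * \<bar>\<alpha> i - \<beta> j\<bar>" and lip0: "\<bar>f i\<bar> \<le> K * \<bar>\<alpha> i\<bar>"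
  shows "ip d (basis_image d r v w f g i) (basis_image d r v w f g i) \<le>
    K\<^sup>2 * ip d (basis_image d r v w \<alpha> \<beta> i) (basis_image d r v w \<alpha> \<beta> i)"
proof -
  have sq: "(f i - g j)\<^sup>2 \<le> K\<^sup>2 * (\<alpha> i - \<beta> j)\<^sup>2" if "j < r" for j
    using power_mono[OF lip[OF that] abs_ge_zero, of 2] by (simp add: power_mult_distrib)
  have sq0: "(f i)\<^sup>2 \<le> K\<^sup>2 * (\<alpha> i)\<^sup>2"
    using power_mono[OF lip0 abs_ge_zero, of 2] by (simp add: power_mult_distrib)
  have "ip d (v i) (v i) = 1" using v i by (simp add: orthonormal_def)
  then have B: "0 \<le> 1 - (\<Sum>j<r. (ip d (v i) (w j))\<^sup>2)" using Bessel[OF w, of "v i"] by simp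
  show ?thesis
    unfolding basis_image_norm[OF v w i] distrib_left sum_distrib_left mult.assoc[symmetric]
    by (intro add_mono sum_mono mult_right_mono) (use sq sq0 B in auto)
qed

text \<open>With \<open>z i\<close> the image of \<open>v i\<close>, the difference of the two forms
  at \<open>a\<close> is the sum of \<open>ip d a (v i) * ip d a (z i)\<close>. Cauchy-Schwarz for
  the sum, Cauchy-Schwarz for each \<open>ip d a (z i)\<close> and Bessel bound its square by the
  sum of the squared norms of the \<open>z i\<close>, which is the squared Frobenius norm of the
  difference of the operators.\<close>

lemma quadratic_form_difference:
  assumes v: "orthonormal d d v" and complete: "\<And>t. t < d \<Longrightarrow> a t = (\<Sum>i<d. ip d a (v i) * v i t)"
    and w: "orthonormal d r w"
  shows "((\<Sum>i<d. f i * (ip d a (v i))\<^sup>2) - (\<Sum>j<r. g j * (ip d a (w j))\<^sup>2))\<^sup>2 \<le>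
    (ip d a a)\<^sup>2 * (\<Sum>i<d. ip d (basis_image d r v w f g i) (basis_image d r v w f g i))"
proof -
  define z where "z = basis_image d r v w f g"
  have aw: "ip d a x = (\<Sum>i<d. ip d a (v i) * ip d (v i) x)" for x
  proof -
    have "ip d a x = ip d (\<lambda>t. \<Sum>i<d. ip d a (v i) * v i t) x"
      unfolding ip_def[of d _ x] by (rule sum.cong) (use complete in auto)
    then show ?thesis by (simp add: ip_simps)
  qed
  have az: "ip d a (z i) = f i * ip d a (v i) - (\<Sum>j<r. g j * ip d (v i) (w j) * ip d a (w j))" for i
    by (simp add: z_def basis_image_def ip_simps)
  have "(\<Sum>i<d. ip d a (v i) * ip d a (z i)) =
      (\<Sum>i<d. f i * (ip d a (v i))\<^sup>2) -
      (\<Sum>i<d. \<Sum>j<r. g j * ip d a (w j) * (ip d a (v i) * ip d (v i) (w j)))"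
    by (simp add: az right_diff_distrib sum_subtractf sum_distrib_left power2_eq_square ac_simps)
  also have "(\<Sum>i<d. \<Sum>j<r. g j * ip d a (w j) * (ip d a (v i) * ip d (v i) (w j))) =
      (\<Sum>j<r. g j * ip d a (w j) * (\<Sum>i<d. ip d a (v i) * ip d (v i) (w j)))"
    by (subst sum.swap) (simp add: sum_distrib_left)
  also have "\<dots> = (\<Sum>j<r. g j * (ip d a (w j))\<^sup>2)"
    by (simp add: aw[symmetric] power2_eq_square ac_simps)
  finally have "((\<Sum>i<d. f i * (ip d a (v i))\<^sup>2) - (\<Sum>j<r. g j * (ip d a (w j))\<^sup>2))\<^sup>2 =
      (\<Sum>i<d. ip d a (v i) * ip d a (z i))\<^sup>2" by simp
  also have "\<dots> \<le> (\<Sum>i<d. (ip d a (v i))\<^sup>2) * (\<Sum>i<d. (ip d a (z i))\<^sup>2)"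
    by (rule sum_Cauchy_Schwarz) simp
  also have "\<dots> \<le> ip d a a * (\<Sum>i<d. ip d a a * ip d (z i) (z i))"
    by (intro mult_mono sum_mono ip_Cauchy_Schwarz Bessel[OF v] ip_nonneg sum_nonneg) auto
  finally show ?thesis
    by (simp add: z_def sum_distrib_left[symmetric] power2_eq_square mult.assoc)
qed

text \<open>For \<open>0 \<le> D \<le> e\<close> one has \<open>D\<^sup>2 \<le> e D\<close>: evaluate \<open>D \<ge> 0\<close> at \<open>v\<^sub>i - D v\<^sub>i / e\<close>.\<close>

lemma basis_image_le_form:
  assumes v: "orthonormal d N v" and w: "orthonormal d r w" and i: "i < N" and e: "0 < e"
    and lower: "\<And>x. (\<Sum>j<r. \<beta> j * (ip d x (w j))\<^sup>2) \<le> (\<Sum>i<N. \<alpha> i * (ip d x (v i))\<^sup>2)"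
    and upper: "\<And>x. (\<Sum>i<N. \<alpha> i * (ip d x (v i))\<^sup>2) \<le> (\<Sum>j<r. \<beta> j * (ip d x (w j))\<^sup>2) + e * ip d x x"
  shows "ip d (basis_image d r v w \<alpha> \<beta> i) (basis_image d r v w \<alpha> \<beta> i) \<le>
    e * (\<alpha> i - (\<Sum>j<r. \<beta> j * (ip d (v i) (w j))\<^sup>2))"
proof -
  define z where "z = basis_image d r v w \<alpha> \<beta> i"
  define D where "D = (\<lambda>x. (\<Sum>i<N. \<alpha> i * (ip d x (v i))\<^sup>2) - (\<Sum>j<r. \<beta> j * (ip d x (w j))\<^sup>2))"
  define c where "c = 1 / e"
  define y where "y = (\<lambda>t. v i t - c * z t)"
  have vi: "ip d (v i) (v l) = (if l = i then 1 else 0)" if "l < N" for l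
    using v i that by (auto simp: orthonormal_def)
  \<comment> \<open>Only one of the two factors \<open>z\<close> is unfolded. The squared norm of
    \<open>z\<close> thus appears as the polar form of \<open>D\<close> at \<open>v i\<close> and
    \<open>z\<close>, which is the mixed term of \<open>D y\<close>.\<close>
  have zz: "ip d z z = \<alpha> i * ip d z (v i) - (\<Sum>j<r. \<beta> j * ip d (v i) (w j) * ip d z (w j))"
    by (subst (2) z_def) (simp add: basis_image_def ip_simps)
  have "(\<Sum>l<N. \<alpha> l * (ip d y (v l))\<^sup>2) =
     (\<Sum>l<N. \<alpha> l * (ip d (v i) (v l))\<^sup>2) - 2 * c * (\<Sum>l<N. \<alpha> l * ip d (v i) (v l) * ip d z (v l))
     + c\<^sup>2 * (\<Sum>l<N. \<alpha> l * (ip d z (v l))\<^sup>2)"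
    by (simp add: y_def ip_simps power2_diff power_mult_distrib algebra_simps
        sum.distrib sum_subtractf sum_distrib_left)
  moreover have "(\<Sum>j<r. \<beta> j * (ip d y (w j))\<^sup>2) =
     (\<Sum>j<r. \<beta> j * (ip d (v i) (w j))\<^sup>2) - 2 * c * (\<Sum>j<r. \<beta> j * ip d (v i) (w j) * ip d z (w j))
     + c\<^sup>2 * (\<Sum>j<r. \<beta> j * (ip d z (w j))\<^sup>2)"
    by (simp add: y_def ip_simps power2_diff power_mult_distrib algebra_simps
        sum.distrib sum_subtractf sum_distrib_left)
  moreover have "(\<Sum>l<N. \<alpha> l * ip d (v i) (v l) * ip d z (v l)) = \<alpha> i * ip d z (v i)"
  proof -
    have "(\<Sum>l<N. \<alpha> l * ip d (v i) (v l) * ip d z (v l)) = (\<Sum>l<N. if l = i then \<alpha> l * ip d z (v l) else 0)"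
      by (rule sum.cong) (auto simp: vi)
    then show ?thesis using i by simp
  qed
  ultimately have "D y = D (v i) - 2 * c * ip d z z + c\<^sup>2 * D z"
    unfolding D_def zz by (simp add: algebra_simps)
  then have Dy: "D y = D (v i) - 2 / e * ip d z z + D z / e\<^sup>2"
    by (simp add: c_def power_divide)
  have "0 \<le> D y" using lower by (simp add: D_def)
  \<comment> \<open>The upper bound on \<open>D\<close> limits the quadratic term to half of the
    mixed one; what remains of \<open>0 \<le> D y\<close> is the claim.\<close>
  moreover have "D z / e\<^sup>2 \<le> ip d z z / e"
    using divide_right_mono[of "D z" "e * ip d z z" "e\<^sup>2"] upper[of z] e
    by (simp add: D_def power2_eq_square)
  ultimately have "ip d z z / e \<le> D (v i)" using Dy by simp
  moreover have "D (v i) = \<alpha> i - (\<Sum>j<r. \<beta> j * (ip d (v i) (w j))\<^sup>2)"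
  proof -
    have "(\<Sum>l<N. \<alpha> l * (ip d (v i) (v l))\<^sup>2) = (\<Sum>l<N. if l = i then \<alpha> l else 0)"
      by (rule sum.cong) (auto simp: vi)
    then show ?thesis using i by (simp add: D_def)
  qed
  ultimately show ?thesis using e by (simp add: z_def field_simps)
qed

text \<open>Three bounds are chained: the difference of the forms by the Frobenius norm for
  \<open>f\<close> and \<open>g\<close>, this by \<open>K\<close> times the one for \<alpha> and
  \<beta>, and the square of the latter by \<open>e\<close> times the trace of the difference. As
  \<beta> is nonnegative, that trace is at most the sum of \<alpha>.\<close>

lemma spectral_function_perturbation:
  assumes v: "orthonormal d d v" and complete: "\<And>a t. t < d \<Longrightarrow> a t = (\<Sum>i<d. ip d a (v i) * v i t)"
    and w: "orthonormal d r w" and e: "0 < e" and \<beta>: "\<And>j. j < r \<Longrightarrow> 0 \<le> \<beta> j"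
    and lower: "\<And>x. (\<Sum>j<r. \<beta> j * (ip d x (w j))\<^sup>2) \<le> (\<Sum>i<d. \<alpha> i * (ip d x (v i))\<^sup>2)"
    and upper: "\<And>x. (\<Sum>i<d. \<alpha> i * (ip d x (v i))\<^sup>2) \<le> (\<Sum>j<r. \<beta> j * (ip d x (w j))\<^sup>2) + e * ip d x x"
    and lip: "\<And>i j. i < d \<Longrightarrow> j < r \<Longrightarrow> \<bar>f i - g j\<bar> \<le> K * \<bar>\<alpha> i - \<beta> j\<bar>"
    and lip0: "\<And>i. i < d \<Longrightarrow> \<bar>f i\<bar> \<le> K * \<bar>\<alpha> i\<bar>"
  shows "((\<Sum>i<d. f i * (ip d a (v i))\<^sup>2) - (\<Sum>j<r. g j * (ip d a (w j))\<^sup>2))\<^sup>2 \<le>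
    (ip d a a)\<^sup>2 * (K\<^sup>2 * (e * (\<Sum>i<d. \<alpha> i)))"
proof -
  have "(\<Sum>i<d. ip d (basis_image d r v w f g i) (basis_image d r v w f g i)) \<le>
      (\<Sum>i<d. K\<^sup>2 * (e * \<alpha> i))"
  proof (rule sum_mono)
    fix i assume i: "i \<in> {..<d}"
    have "ip d (basis_image d r v w f g i) (basis_image d r v w f g i) \<le>
        K\<^sup>2 * ip d (basis_image d r v w \<alpha> \<beta> i) (basis_image d r v w \<alpha> \<beta> i)"
      by (rule basis_image_Lipschitz[OF v w]) (use i lip lip0 in auto)
    also have "\<dots> \<le> K\<^sup>2 * (e * (\<alpha> i - (\<Sum>j<r. \<beta> j * (ip d (v i) (w j))\<^sup>2)))"
      by (intro mult_left_mono basis_image_le_form[OF v w _ e lower upper]) (use i in auto)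
    also have "\<dots> \<le> K\<^sup>2 * (e * \<alpha> i)"
      using e \<beta> by (intro mult_left_mono) (auto intro!: sum_nonneg)
    finally show "ip d (basis_image d r v w f g i) (basis_image d r v w f g i) \<le> K\<^sup>2 * (e * \<alpha> i)" .
  qed
  then have "(ip d a a)\<^sup>2 * (\<Sum>i<d. ip d (basis_image d r v w f g i) (basis_image d r v w f g i)) \<le>
      (ip d a a)\<^sup>2 * (K\<^sup>2 * (e * (\<Sum>i<d. \<alpha> i)))"
    by (intro mult_left_mono) (simp_all add: sum_distrib_left)
  with quadratic_form_difference[where a = a and f = f and g = g, OF v complete w]
  show ?thesis by linarith
qed

section \<open>Frequent Directions\<close>

abbreviation (input) row_fun :: "real mat \<Rightarrow> nat \<Rightarrow> nat \<Rightarrow> real" where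
  "row_fun M i \<equiv> \<lambda>t. M $$ (i, t)"

abbreviation (input) col_fun :: "real mat \<Rightarrow> nat \<Rightarrow> nat \<Rightarrow> real" where
  "col_fun M j \<equiv> \<lambda>t. M $$ (t, j)"

text \<open>This is the squared norm of \<open>M x\<close>, the quadratic form of the Gram matrix
  \<open>M^T M\<close>. As a sum over rows it grows by one square when a zero row is
  overwritten.\<close>

definition gram_form :: "real mat \<Rightarrow> (nat \<Rightarrow> real) \<Rightarrow> real" where
  "gram_form M x = (\<Sum>i<dim_row M. (ip (dim_col M) x (row_fun M i))\<^sup>2)"

lemma orthonormal_col_fun:
  assumes W: "W \<in> carrier_mat d r" and 1: "transpose_mat W * W = 1\<^sub>m r"
  shows "orthonormal d r (col_fun W)"
  unfolding orthonormal_def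
proof (intro allI impI)
  fix i j assume ij: "i < r" "j < r"
  then have "ip d (col_fun W i) (col_fun W j) = (transpose_mat W * W) $$ (i, j)"
    using W by (simp add: ip_def scalar_prod_def atLeast0LessThan)
  then show "ip d (col_fun W i) (col_fun W j) = (if i = j then 1 else 0)"
    using ij by (simp add: 1)
qed

lemma mult_mat_diag_transpose_index:
  fixes Q W :: "real mat"
  assumes "Q \<in> carrier_mat p r" "W \<in> carrier_mat q r" "i < p" "t < q"
  shows "(Q * mat_diag r f * transpose_mat W) $$ (i, t) = (\<Sum>j<r. Q $$ (i, j) * f j * W $$ (t, j))"
  unfolding mat_diag_mult_right[OF assms(1)] using assms
  by (simp add: scalar_prod_def atLeast0LessThan)

context
  fixes M Q W :: "real mat" and s :: "real vec"
  assumes svd_M: "is_svd M (Q, s, W)"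
begin

private abbreviation (input) "r \<equiv> min (dim_row M) (dim_col M)"

lemma svd_carrier:
  "Q \<in> carrier_mat (dim_row M) r" "dim_vec s = r" "W \<in> carrier_mat (dim_col M) r"
  using svd_M by (auto simp: is_svd_def Let_def)

lemma svd_values_nonneg: "j < r \<Longrightarrow> 0 \<le> s $ j"
  using svd_M by (simp add: is_svd_def Let_def)

lemma svd_values_antimono: "i \<le> j \<Longrightarrow> j < r \<Longrightarrow> s $ j \<le> s $ i"
  using svd_M by (simp add: is_svd_def Let_def)

lemma svd_right_orthonormal: "orthonormal (dim_col M) r (col_fun W)"
  using svd_M by (intro orthonormal_col_fun) (simp_all add: is_svd_def Let_def)

lemma svd_left_orthonormal: "orthonormal (dim_row M) r (col_fun Q)"
  using svd_M by (intro orthonormal_col_fun) (simp_all add: is_svd_def Let_def)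

lemma svd_index:
  assumes "i < dim_row M" "t < dim_col M"
  shows "M $$ (i, t) = (\<Sum>j<r. Q $$ (i, j) * s $ j * W $$ (t, j))"
proof -
  have "M = Q * mat_diag r (\<lambda>j. s $ j) * transpose_mat W"
    using svd_M by (simp add: is_svd_def Let_def)
  from arg_cong[OF this, of "\<lambda>M. M $$ (i, t)"] show ?thesis
    unfolding mult_mat_diag_transpose_index[OF svd_carrier(1,3) assms] .
qed

text \<open>The vector \<open>M x\<close> has the coordinates \<open>z j\<close> with respect to the
  orthonormal columns of \<open>Q\<close>, so \<open>Q\<close> drops out of its norm.\<close>

lemma svd_gram_form: "gram_form M x = (\<Sum>j<r. (s $ j)\<^sup>2 * (ip (dim_col M) x (col_fun W j))\<^sup>2)"
proof -
  define z where "z j = s $ j * ip (dim_col M) x (col_fun W j)" for j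
  have "ip (dim_col M) x (row_fun M i) = (\<Sum>j<r. z j * Q $$ (i, j))" if "i < dim_row M" for i
  proof -
    have "ip (dim_col M) x (row_fun M i) =
        ip (dim_col M) x (\<lambda>t. \<Sum>j<r. (Q $$ (i, j) * s $ j) * W $$ (t, j))"
      unfolding ip_def by (rule sum.cong) (use svd_index[OF that] in auto)
    then show ?thesis by (simp add: ip_simps z_def ac_simps)
  qed
  then have "gram_form M x =
      ip (dim_row M) (\<lambda>i. \<Sum>j<r. z j * col_fun Q j i) (\<lambda>i. \<Sum>j<r. z j * col_fun Q j i)"
    by (simp add: gram_form_def ip_def[of "dim_row M"] power2_eq_square)
  also have "\<dots> = (\<Sum>j<r. (z j)\<^sup>2)"
    by (rule orthonormal_combination_norm[OF svd_left_orthonormal])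
  finally show ?thesis by (simp add: z_def power_mult_distrib)
qed

text \<open>The same argument, applied to every column of \<open>M\<close>, removes
  \<open>Q\<close>; summation over these columns then uses that the columns of \<open>W\<close> are
  unit vectors.\<close>

lemma svd_sq_frobenius: "sq_frobenius M = (\<Sum>j<r. (s $ j)\<^sup>2)"
proof -
  have "(\<Sum>i<dim_row M. (M $$ (i, t))\<^sup>2) = (\<Sum>j<r. (s $ j)\<^sup>2 * (W $$ (t, j))\<^sup>2)" if "t < dim_col M" for t
  proof -
    have "(\<Sum>i<dim_row M. (M $$ (i, t))\<^sup>2) = ip (dim_row M)
        (\<lambda>i. \<Sum>j<r. (s $ j * W $$ (t, j)) * col_fun Q j i) (\<lambda>i. \<Sum>j<r. (s $ j * W $$ (t, j)) * col_fun Q j i)"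
      unfolding ip_def power2_eq_square
      by (rule sum.cong) (use svd_index[OF _ that] in \<open>auto simp: ac_simps\<close>)
    also have "\<dots> = (\<Sum>j<r. (s $ j * W $$ (t, j))\<^sup>2)"
      by (rule orthonormal_combination_norm[OF svd_left_orthonormal])
    finally show ?thesis by (simp add: power_mult_distrib)
  qed
  then have "sq_frobenius M = (\<Sum>t<dim_col M. \<Sum>j<r. (s $ j)\<^sup>2 * (W $$ (t, j))\<^sup>2)"
    unfolding sq_frobenius_def by (subst sum.swap) simp
  also have "\<dots> = (\<Sum>j<r. (s $ j)\<^sup>2 * ip (dim_col M) (col_fun W j) (col_fun W j))"
    by (subst sum.swap) (simp add: ip_def sum_distrib_left power2_eq_square)
  also have "\<dots> = (\<Sum>j<r. (s $ j)\<^sup>2)"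
    using svd_right_orthonormal by (intro sum.cong) (auto simp: orthonormal_def)
  finally show ?thesis .
qed

end

lemma sq_frobenius_nonneg: "0 \<le> sq_frobenius M"
  unfolding sq_frobenius_def by (intro sum_nonneg) simp

lemma sq_frobenius_rows: "sq_frobenius M = (\<Sum>i<dim_row M. ip (dim_col M) (row_fun M i) (row_fun M i))"
  by (simp add: sq_frobenius_def ip_def power2_eq_square)

text \<open>The quadratic form decreases from \<open>g\<close> to \<open>g'\<close> by at most \<open>e\<close>, and this loss is paid for \<open>l\<close>-fold
  by the decrease of the squared Frobenius norm from \<open>f\<close> to \<open>f'\<close>.\<close>

definition shrinks_to ::
  "nat \<Rightarrow> nat \<Rightarrow> real \<Rightarrow> ((nat \<Rightarrow> real) \<Rightarrow> real) \<Rightarrow> real \<Rightarrow> ((nat \<Rightarrow> real) \<Rightarrow> real) \<Rightarrow> real \<Rightarrow> bool" where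
  "shrinks_to d l e g f g' f' \<longleftrightarrow> 0 \<le> e \<and> real l * e + f' \<le> f \<and>
     (\<forall>x. g' x \<le> g x \<and> g x \<le> g' x + e * ip d x x)"

lemma shrinks_to_refl: "shrinks_to d l 0 g f g f"
  by (simp add: shrinks_to_def)

lemma shrinks_to_trans:
  assumes "shrinks_to d l e g f g' f'" "shrinks_to d l e' g' f' g'' f''"
  shows "shrinks_to d l (e + e') g f g'' f''"
  unfolding shrinks_to_def
proof (intro conjI allI)
  show "0 \<le> e + e'" "real l * (e + e') + f'' \<le> f"
    using assms by (auto simp: shrinks_to_def algebra_simps)
  fix x
  have 1: "g' x \<le> g x" "g x \<le> g' x + e * ip d x x" "g'' x \<le> g' x" "g' x \<le> g'' x + e' * ip d x x"
    using assms by (auto simp: shrinks_to_def)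
  show "g'' x \<le> g x" using 1 by linarith
  show "g x \<le> g'' x + (e + e') * ip d x x" using 1 by (simp add: algebra_simps)
qed

text \<open>Rows that are still to arrive contribute equally before and after a shrinking step.
  Adding them on both sides prepares the chaining along the stream.\<close>

lemma shrinks_to_add:
  assumes "shrinks_to d l e g f g' f'"
  shows "shrinks_to d l e (\<lambda>x. g x + h x) (f + c) (\<lambda>x. g' x + h x) (f' + c)"
  using assms by (auto simp: shrinks_to_def algebra_simps)

text \<open>The summand \<open>a\<close> collects what earlier results still occupy, so the rule can
  be iterated through nested binds. Memory goals are therefore first stated in the form
  \<open>0 + mem ...\<close>.\<close>

lemma mem_bind_comp_leI:
  assumes "a + mem m \<le> X" "a + reals_stored (res m) + mem (f (res m)) \<le> X"
  shows "a + mem (bind_comp m f) \<le> X"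
  using assms by (auto simp: bind_comp_def Let_def max_def)

lemma time_bind_comp: "time (bind_comp m f) = time m + time (f (res m))"
  by (simp add: bind_comp_def Let_def)

lemmas reals_stored_simps = reals_stored_prod_def reals_stored_mat_def reals_stored_vec_def
  reals_stored_real_def reals_stored_option_def

section \<open>A single shrinking step\<close>

context
  fixes R :: svd_routine and l :: nat and B Q W :: "real mat" and s :: "real vec"
  assumes svd_B: "svd R B = (Q, s, W)" and is_svd_B: "is_svd B (Q, s, W)"
begin

private abbreviation (input) "rk \<equiv> min (dim_row B) (dim_col B)"
private abbreviation (input) "\<delta> \<equiv> (entry0 s (l - 1))\<^sup>2"
private abbreviation (input) "\<tau> j \<equiv> sqrt (max ((s $ j)\<^sup>2 - \<delta>) 0)"

lemma res_shrink:
  "res (shrink R l B) =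
     mat (dim_row B) rk (\<lambda>(i, j). if i = j then \<tau> j else 0) * transpose_mat W"
proof -
  have "mat m (dim_vec s) (\<lambda>(i, j). if i = j then vec (dim_vec s) f $ j else 0) =
      mat m (dim_vec s) (\<lambda>(i, j). if i = j then f j else 0)" for m and f :: "nat \<Rightarrow> real"
    by (rule cong_mat) auto
  then show ?thesis
    unfolding shrink_def res_bind_comp svd_c_def comp.sel svd_B prod.case scalar_c_def
      vec_c_def mat_c_def transpose_c_def mult_c_def svd_carrier(2)[OF is_svd_B] by simp
qed

lemma shrink_dims:
  "dim_row (res (shrink R l B)) = dim_row B" "dim_col (res (shrink R l B)) = dim_col B"
  using svd_carrier[OF is_svd_B] unfolding res_shrink by auto

lemma shrink_index:
  assumes "i < dim_row B" "t < dim_col B"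
  shows "res (shrink R l B) $$ (i, t) = (if i < rk then \<tau> i * W $$ (t, i) else 0)"
proof -
  have "res (shrink R l B) $$ (i, t) = (\<Sum>j<rk. (if i = j then \<tau> j else 0) * W $$ (t, j))"
    using svd_carrier[OF is_svd_B] assms unfolding res_shrink
    by (simp add: scalar_prod_def atLeast0LessThan)
  also have "\<dots> = (\<Sum>j<rk. if j = i then \<tau> j * W $$ (t, j) else 0)"
    by (rule sum.cong) auto
  finally show ?thesis by simp
qed

text \<open>Singular values decrease, so from index \<open>l\<close> on they are at most the one
  that defines the threshold, and the maximum with 0 is 0. Rows beyond the number of singular values
  are zero anyway.\<close>

lemma shrink_row_zero:
  assumes "l \<le> i" "i < dim_row B" "t < dim_col B"
  shows "res (shrink R l B) $$ (i, t) = 0"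
proof (cases "i < rk")
  case True
  then have "s $ i \<le> entry0 s (l - 1)" "0 \<le> s $ i"
    using svd_values_antimono[OF is_svd_B, of "l - 1" i] svd_values_nonneg[OF is_svd_B, of i]
      svd_carrier(2)[OF is_svd_B] assms(1) by (auto simp: entry0_def)
  then have "(s $ i)\<^sup>2 \<le> \<delta>" by (intro power_mono)
  then show ?thesis unfolding shrink_index[OF assms(2,3)] by simp
next
  case False
  then show ?thesis unfolding shrink_index[OF assms(2,3)] by (simp only: if_False)
qed

lemma shrink_row_ip:
  assumes "i < dim_row B"
  shows "ip (dim_col B) x (row_fun (res (shrink R l B)) i) =
    (if i < rk then \<tau> i * ip (dim_col B) x (col_fun W i) else 0)"
proof -
  have "ip (dim_col B) x (row_fun (res (shrink R l B)) i) =
      (\<Sum>t<dim_col B. x t * (if i < rk then \<tau> i * W $$ (t, i) else 0))"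
    unfolding ip_def by (rule sum.cong) (use shrink_index[OF assms] in auto)
  also have "\<dots> = (if i < rk then \<Sum>t<dim_col B. \<tau> i * (x t * W $$ (t, i)) else 0)"
    by (cases "i < rk") (simp_all only: if_True if_False mult_zero_right mult_zero_left sum.neutral_const ac_simps)
  finally show ?thesis by (simp only: ip_def sum_distrib_left)
qed

lemma sum_rows_shrink:
  fixes f :: "nat \<Rightarrow> real"
  assumes "\<And>i. i < dim_row B \<Longrightarrow> f i = (if i < rk then g i else 0)"
  shows "(\<Sum>i<dim_row B. f i) = (\<Sum>i<rk. g i)"
  by (rule sum.mono_neutral_cong_right) (use assms in auto)

lemma gram_form_shrink:
  "gram_form (res (shrink R l B)) x = (\<Sum>i<rk. max ((s $ i)\<^sup>2 - \<delta>) 0 * (ip (dim_col B) x (col_fun W i))\<^sup>2)"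
  unfolding gram_form_def shrink_dims
  by (rule sum_rows_shrink) (simp add: shrink_row_ip power_mult_distrib)

lemma sq_frobenius_shrink: "sq_frobenius (res (shrink R l B)) = (\<Sum>i<rk. max ((s $ i)\<^sup>2 - \<delta>) 0)"
  unfolding sq_frobenius_rows shrink_dims
proof (rule sum_rows_shrink)
  fix i assume i: "i < dim_row B"
  have "ip (dim_col B) (col_fun W i) (col_fun W i) = 1" if "i < rk"
    using svd_right_orthonormal[OF is_svd_B] that by (simp add: orthonormal_def)
  then show "ip (dim_col B) (row_fun (res (shrink R l B)) i) (row_fun (res (shrink R l B)) i) =
      (if i < rk then max ((s $ i)\<^sup>2 - \<delta>) 0 else 0)"
    using i by (simp add: shrink_row_ip ip_commute[of _ "row_fun _ _" "col_fun _ _"])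
qed

text \<open>Every squared singular value loses at most \<delta>, so by Bessel the form loses at most
  \<delta> times the squared norm. The first \<open>l\<close> of them lose exactly \<delta>, which
  takes \<open>l\<close> times \<delta> off the squared Frobenius norm.\<close>

lemma shrink_shrinks_to:
  "shrinks_to (dim_col B) l \<delta> (gram_form B) (sq_frobenius B)
     (gram_form (res (shrink R l B))) (sq_frobenius (res (shrink R l B)))"
  unfolding shrinks_to_def
proof (intro conjI allI)
  show "0 \<le> \<delta>" by simp
  show "real l * \<delta> + sq_frobenius (res (shrink R l B)) \<le> sq_frobenius B"
  proof (cases "l \<le> rk")
    case True
    have "(\<Sum>i<rk. if i < l then \<delta> else 0) = (\<Sum>i<l. \<delta>)"
      by (rule sum.mono_neutral_cong_right) (use True in auto)
    then have "real l * \<delta> = (\<Sum>i<rk. if i < l then \<delta> else 0)" by simp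
    moreover have "(if i < l then \<delta> else 0) + max ((s $ i)\<^sup>2 - \<delta>) 0 \<le> (s $ i)\<^sup>2" if "i < rk" for i
    proof (cases "i < l")
      case il: True
      have "entry0 s (l - 1) \<le> s $ i" "0 \<le> entry0 s (l - 1)"
        using svd_values_antimono[OF is_svd_B, of i "l - 1"] svd_values_nonneg[OF is_svd_B, of "l - 1"]
          svd_carrier(2)[OF is_svd_B] True il by (auto simp: entry0_def)
      then have "\<delta> \<le> (s $ i)\<^sup>2" by (intro power_mono)
      then show ?thesis using il by simp
    qed simp
    then have "(\<Sum>i<rk. (if i < l then \<delta> else 0) + max ((s $ i)\<^sup>2 - \<delta>) 0) \<le> (\<Sum>i<rk. (s $ i)\<^sup>2)"
      by (intro sum_mono) auto
    ultimately show ?thesis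
      unfolding svd_sq_frobenius[OF is_svd_B] sq_frobenius_shrink by (simp add: sum.distrib)
  next
    case False
    \<comment> \<open>With fewer than \<open>l\<close> singular values, index \<open>l - 1\<close>
      lies in the zero padding of \<open>entry0\<close>, and nothing is subtracted.\<close>
    then have "\<delta> = 0" using svd_carrier(2)[OF is_svd_B] by (auto simp: entry0_def)
    then show ?thesis
      unfolding svd_sq_frobenius[OF is_svd_B] sq_frobenius_shrink by simp
  qed
  fix x
  show "gram_form (res (shrink R l B)) x \<le> gram_form B x"
    unfolding svd_gram_form[OF is_svd_B] gram_form_shrink
    by (intro sum_mono mult_right_mono) auto
  have "gram_form B x \<le>
      (\<Sum>i<rk. max ((s $ i)\<^sup>2 - \<delta>) 0 * (ip (dim_col B) x (col_fun W i))\<^sup>2 + \<delta> * (ip (dim_col B) x (col_fun W i))\<^sup>2)"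
    unfolding svd_gram_form[OF is_svd_B] distrib_right[symmetric]
    by (intro sum_mono mult_right_mono) auto
  also have "\<dots> = gram_form (res (shrink R l B)) x + \<delta> * (\<Sum>i<rk. (ip (dim_col B) x (col_fun W i))\<^sup>2)"
    by (simp add: gram_form_shrink sum.distrib sum_distrib_left)
  also have "\<dots> \<le> gram_form (res (shrink R l B)) x + \<delta> * ip (dim_col B) x x"
    using Bessel[OF svd_right_orthonormal[OF is_svd_B]] by (intro add_left_mono mult_left_mono) auto
  finally show "gram_form B x \<le> gram_form (res (shrink R l B)) x + \<delta> * ip (dim_col B) x x" .
qed

lemma time_shrink:
  "time (shrink R l B) = svd_time R (dim_row B) (dim_col B) + 1 + 4 * dim_vec s
     + dim_row B * dim_vec s + dim_col B * dim_vec s + 2 * dim_row B * dim_vec s * dim_col B"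
proof -
  have "dim_row W = dim_col B" "dim_col W = dim_vec s" using svd_carrier[OF is_svd_B] by auto
  then show ?thesis
    by (simp add: shrink_def time_bind_comp svd_c_def svd_B scalar_c_def vec_c_def mat_c_def
        transpose_c_def mult_c_def)
qed

text \<open>The factor 2 arises because the three SVD factors are kept while \<open>S'\<close>,
  \<open>t\<close> and \<open>Wt\<close>, of the same sizes, are built. The summand 1 is the
  threshold, and the last product is the new buffer.\<close>

lemma mem_shrink:
  "mem (shrink R l B) \<le> svd_work R (dim_row B) (dim_col B)
     + 2 * (dim_row B * dim_vec s + dim_vec s + dim_col B * dim_vec s) + 1 + dim_row B * dim_col B"
    (is "_ \<le> ?X")
proof -
  have dims: "dim_row W = dim_col B" "dim_col W = dim_vec s" "dim_row Q = dim_row B" "dim_col Q = dim_vec s"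
    using svd_carrier[OF is_svd_B] by auto
  have "0 + mem (shrink R l B) \<le> ?X"
    unfolding shrink_def
    apply (rule mem_bind_comp_leI)
    subgoal by (simp add: svd_c_def svd_B reals_stored_simps dims)
    unfolding svd_c_def comp.sel svd_B prod.case
    apply (intro mem_bind_comp_leI)
    apply (simp_all add: scalar_c_def vec_c_def mat_c_def transpose_c_def mult_c_def
        reals_stored_simps dims algebra_simps)
    done
  then show ?thesis by simp
qed

end

section \<open>Zero rows of the buffer and insertion of a row\<close>

definition nonzero_rows :: "real mat \<Rightarrow> nat" where
  "nonzero_rows B = card {i. i < dim_row B \<and> row B i \<noteq> 0\<^sub>v (dim_col B)}"

lemma find_zero_row_None:
  assumes "res (find_zero_row_c B) = None"
  shows "nonzero_rows B = dim_row B"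
proof -
  have "{i. i < dim_row B \<and> row B i \<noteq> 0\<^sub>v (dim_col B)} = {..<dim_row B}"
    using assms by (auto simp: find_zero_row_c_def split: if_splits)
  then show ?thesis by (simp add: nonzero_rows_def)
qed

lemma find_zero_row_exists:
  assumes "nonzero_rows B < dim_row B"
  obtains z where "res (find_zero_row_c B) = Some z" "z < dim_row B" "row B z = 0\<^sub>v (dim_col B)"
proof -
  have "res (find_zero_row_c B) \<noteq> None"
    using find_zero_row_None[of B] assms by auto
  then have ex: "\<exists>i<dim_row B. row B i = 0\<^sub>v (dim_col B)"
    by (auto simp: find_zero_row_c_def split: if_splits)
  then have "(LEAST i. i < dim_row B \<and> row B i = 0\<^sub>v (dim_col B)) < dim_row B \<and>
      row B (LEAST i. i < dim_row B \<and> row B i = 0\<^sub>v (dim_col B)) = 0\<^sub>v (dim_col B)"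
    by (rule LeastI_ex)
  then show ?thesis using ex by (intro that) (auto simp: find_zero_row_c_def)
qed

lemma nonzero_rows_shrink:
  assumes "svd R B = (Q, s, W)" "is_svd B (Q, s, W)"
  shows "nonzero_rows (res (shrink R l B)) \<le> l"
proof -
  have "{i. i < dim_row B \<and> row (res (shrink R l B)) i \<noteq> 0\<^sub>v (dim_col B)} \<subseteq> {..<l}"
  proof
    fix i assume i: "i \<in> {i. i < dim_row B \<and> row (res (shrink R l B)) i \<noteq> 0\<^sub>v (dim_col B)}"
    have "row (res (shrink R l B)) i = 0\<^sub>v (dim_col B)" if "l \<le> i"
      by (rule eq_vecI) (use i that in \<open>auto simp: shrink_dims[OF assms] shrink_row_zero[OF assms]\<close>)
    then show "i \<in> {..<l}" using i by (auto simp: not_less[symmetric])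
  qed
  then have "card {i. i < dim_row B \<and> row (res (shrink R l B)) i \<noteq> 0\<^sub>v (dim_col B)} \<le> card {..<l}"
    by (intro card_mono) auto
  then show ?thesis by (simp add: nonzero_rows_def shrink_dims[OF assms])
qed

context
  fixes B :: "real mat" and z :: nat and a :: "real vec"
  assumes z: "z < dim_row B" "row B z = 0\<^sub>v (dim_col B)" and a: "a \<in> carrier_vec (dim_col B)"
begin

lemma insert_row_dims:
  "dim_row (res (insert_row B z a)) = dim_row B" "dim_col (res (insert_row B z a)) = dim_col B"
  by (simp_all add: insert_row_def mat_c_def)

lemma insert_row_index:
  assumes "i < dim_row B" "t < dim_col B"
  shows "res (insert_row B z a) $$ (i, t) = (if i = z then a $ t else B $$ (i, t))"
  using assms by (simp add: insert_row_def mat_c_def)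

lemma zero_row_index: "t < dim_col B \<Longrightarrow> B $$ (z, t) = 0"
  using z by (metis index_row(1) index_zero_vec(1))

text \<open>Only the summand of row \<open>z\<close> changes, and it was 0 before. This yields the
  growth of both the Gram form and the Frobenius norm.\<close>

lemma sum_rows_insert:
  fixes f g :: "nat \<Rightarrow> real"
  assumes "\<And>i. i < dim_row B \<Longrightarrow> i \<noteq> z \<Longrightarrow> f i = g i" "g z = 0"
  shows "(\<Sum>i<dim_row B. f i) = (\<Sum>i<dim_row B. g i) + f z"
proof -
  have "(\<Sum>i \<in> {..<dim_row B} - {z}. f i) = (\<Sum>i \<in> {..<dim_row B} - {z}. g i)"
    by (rule sum.cong) (use assms(1) in auto)
  then show ?thesis
    using z(1) assms(2) by (simp add: sum.remove[of "{..<dim_row B}" z])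
qed

lemma gram_form_insert_row:
  "gram_form (res (insert_row B z a)) x = gram_form B x + (ip (dim_col B) x (\<lambda>t. a $ t))\<^sup>2"
proof -
  have "ip (dim_col B) x (row_fun (res (insert_row B z a)) z) = ip (dim_col B) x (\<lambda>t. a $ t)"
    unfolding ip_def by (rule sum.cong) (use z insert_row_index in auto)
  then show ?thesis
    unfolding gram_form_def insert_row_dims
    by (subst sum_rows_insert[where g = "\<lambda>i. (ip (dim_col B) x (row_fun B i))\<^sup>2"])
      (auto simp: ip_def zero_row_index insert_row_index)
qed

lemma sq_frobenius_insert_row:
  "sq_frobenius (res (insert_row B z a)) = sq_frobenius B + ip (dim_col B) (\<lambda>t. a $ t) (\<lambda>t. a $ t)"
  unfolding sq_frobenius_def insert_row_dims
  by (subst sum_rows_insert[where g = "\<lambda>i. \<Sum>t<dim_col B. (B $$ (i, t))\<^sup>2"])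
    (use z in \<open>auto simp: ip_def zero_row_index insert_row_index power2_eq_square\<close>)

lemma nonzero_rows_insert_row: "nonzero_rows (res (insert_row B z a)) \<le> nonzero_rows B + 1"
proof -
  have "{i. i < dim_row B \<and> row (res (insert_row B z a)) i \<noteq> 0\<^sub>v (dim_col B)} \<subseteq>
      insert z {i. i < dim_row B \<and> row B i \<noteq> 0\<^sub>v (dim_col B)}"
  proof
    fix i assume i: "i \<in> {i. i < dim_row B \<and> row (res (insert_row B z a)) i \<noteq> 0\<^sub>v (dim_col B)}"
    have "row (res (insert_row B z a)) i = row B i" if "i \<noteq> z"
      by (rule eq_vecI) (use i that in \<open>auto simp: insert_row_dims insert_row_index\<close>)
    then show "i \<in> insert z {i. i < dim_row B \<and> row B i \<noteq> 0\<^sub>v (dim_col B)}" using i by auto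
  qed
  then have "card {i. i < dim_row B \<and> row (res (insert_row B z a)) i \<noteq> 0\<^sub>v (dim_col B)} \<le>
      card (insert z {i. i < dim_row B \<and> row B i \<noteq> 0\<^sub>v (dim_col B)})"
    by (intro card_mono) auto
  also have "\<dots> \<le> card {i. i < dim_row B \<and> row B i \<noteq> 0\<^sub>v (dim_col B)} + 1"
    by (simp add: card_insert_if)
  finally show ?thesis by (simp add: nonzero_rows_def insert_row_dims)
qed

end

section \<open>The first pass and its amortised cost\<close>

definition shrink_time :: "svd_routine \<Rightarrow> nat \<Rightarrow> nat \<Rightarrow> nat" where
  "shrink_time R l d = (let r = min (2 * l) d in
     svd_time R (2 * l) d + 1 + 4 * r + 2 * l * r + d * r + 4 * l * r * d)"

definition shrink_mem :: "svd_routine \<Rightarrow> nat \<Rightarrow> nat \<Rightarrow> nat" where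
  "shrink_mem R l d = (let r = min (2 * l) d in
     svd_work R (2 * l) d + 2 * (2 * l * r + r + d * r) + 1 + 2 * l * d)"

context
  fixes R :: svd_routine and l d :: nat
  assumes is_svd: "\<And>M. is_svd M (svd R M)" and l: "1 \<le> l"
begin

text \<open>The single step is repackaged for the fixed shape \<open>2 * l\<close> by
  \<open>d\<close>. The SVD factors disappear from the statement, so that it can be iterated along
  the stream.\<close>

lemma shrink_buffer:
  assumes "B \<in> carrier_mat (2 * l) d"
  shows "res (shrink R l B) \<in> carrier_mat (2 * l) d"
    and "nonzero_rows (res (shrink R l B)) \<le> l"
    and "\<exists>e. shrinks_to d l e (gram_form B) (sq_frobenius B)
           (gram_form (res (shrink R l B))) (sq_frobenius (res (shrink R l B)))"
    and "\<And>i t. l \<le> i \<Longrightarrow> i < 2 * l \<Longrightarrow> t < d \<Longrightarrow> res (shrink R l B) $$ (i, t) = 0"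
    and "time (shrink R l B) = shrink_time R l d"
    and "mem (shrink R l B) \<le> shrink_mem R l d"
proof -
  obtain Q s W where svd_B: "svd R B = (Q, s, W)" by (cases "svd R B") auto
  have is_svd_B: "is_svd B (Q, s, W)" using is_svd[of B] svd_B by simp
  note B = svd_B is_svd_B
  have dims: "dim_row B = 2 * l" "dim_col B = d" "dim_vec s = min (2 * l) d"
    using assms svd_carrier(2)[OF is_svd_B] by auto
  show "res (shrink R l B) \<in> carrier_mat (2 * l) d"
    using shrink_dims[OF B] dims by (intro carrier_matI) auto
  show "nonzero_rows (res (shrink R l B)) \<le> l" by (rule nonzero_rows_shrink[OF B])
  show "\<exists>e. shrinks_to d l e (gram_form B) (sq_frobenius B)
           (gram_form (res (shrink R l B))) (sq_frobenius (res (shrink R l B)))"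
    using shrink_shrinks_to[OF B, of l] dims by auto
  show "\<And>i t. l \<le> i \<Longrightarrow> i < 2 * l \<Longrightarrow> t < d \<Longrightarrow> res (shrink R l B) $$ (i, t) = 0"
    using shrink_row_zero[OF B] dims by auto
  show "time (shrink R l B) = shrink_time R l d"
    unfolding time_shrink[OF B] dims by (simp add: shrink_time_def Let_def)
  show "mem (shrink R l B) \<le> shrink_mem R l d"
    using mem_shrink[OF B, of l] unfolding dims by (simp add: shrink_mem_def Let_def)
qed

text \<open>The truncated potential \<open>nonzero_rows B - l\<close> pays for the next shrinking step: a shrinking step lowers
  it from \<open>l\<close> to \<open>0\<close>, every insertion raises it by at most one.\<close>

lemma fd_update_buffer:
  assumes B: "B \<in> carrier_mat (2 * l) d" and nz: "nonzero_rows B < 2 * l" and a: "a \<in> carrier_vec d"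
  shows "res (fd_update R l a B) \<in> carrier_mat (2 * l) d"
    and "nonzero_rows (res (fd_update R l a B)) < 2 * l"
    and "\<exists>e. shrinks_to d l e (\<lambda>x. gram_form B x + (ip d x (\<lambda>t. a $ t))\<^sup>2)
           (sq_frobenius B + ip d (\<lambda>t. a $ t) (\<lambda>t. a $ t))
           (gram_form (res (fd_update R l a B))) (sq_frobenius (res (fd_update R l a B)))"
    and "l * time (fd_update R l a B) + (nonzero_rows (res (fd_update R l a B)) - l) * shrink_time R l d
      \<le> l * (6 * l * d) + (nonzero_rows B - l + 1) * shrink_time R l d"
    and "mem (fd_update R l a B) \<le> 2 * l * d + shrink_mem R l d"
proof -
  have dims: "dim_row B = 2 * l" "dim_col B = d" using B by auto
  obtain z where z: "res (find_zero_row_c B) = Some z" "z < dim_row B" "row B z = 0\<^sub>v (dim_col B)"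
    using find_zero_row_exists[of B] nz dims by auto
  have a': "a \<in> carrier_vec (dim_col B)" using a dims by simp
  define B' where "B' = res (insert_row B z a)"
  have B': "B' \<in> carrier_mat (2 * l) d"
    using insert_row_dims[OF z(2,3) a'] dims by (intro carrier_matI) (auto simp: B'_def)
  have dims': "dim_row B' = 2 * l" "dim_col B' = d" using B' by auto
  have gram': "gram_form B' = (\<lambda>x. gram_form B x + (ip d x (\<lambda>t. a $ t))\<^sup>2)"
    using gram_form_insert_row[OF z(2,3) a'] dims by (auto simp: B'_def)
  have frob': "sq_frobenius B' = sq_frobenius B + ip d (\<lambda>t. a $ t) (\<lambda>t. a $ t)"
    using sq_frobenius_insert_row[OF z(2,3) a'] dims by (auto simp: B'_def)
  have nz': "nonzero_rows B' \<le> nonzero_rows B + 1"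
    using nonzero_rows_insert_row[OF z(2,3) a'] by (simp add: B'_def)
  define next_step where "next_step = (if res (find_zero_row_c B') = None then shrink R l B' else return_comp B')"
  have res: "res (fd_update R l a B) = res next_step"
    by (simp add: fd_update_def res_bind_comp z(1) next_step_def B'_def)
  \<comment> \<open>Three traversals of the \<open>2 * l\<close> by \<open>d\<close> buffer: the
    search for a zero row, the copy with the inserted row, and the second search.\<close>
  have time: "time (fd_update R l a B) = 6 * l * d + time next_step"
    using dims dims'
    by (simp add: fd_update_def time_bind_comp z(1) next_step_def B'_def[symmetric])
      (simp add: find_zero_row_c_def insert_row_def mat_c_def)
  have mem: "mem (fd_update R l a B) \<le> 2 * l * d + mem next_step"
  proof -
    have "0 + mem (fd_update R l a B) \<le> 2 * l * d + mem next_step"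
      unfolding fd_update_def
      by (intro mem_bind_comp_leI; simp add: z(1) B'_def[symmetric] next_step_def[symmetric] del: add_0)
        (use dims dims' in \<open>auto simp: next_step_def find_zero_row_c_def insert_row_def mat_c_def reals_stored_simps\<close>)
    then show ?thesis by simp
  qed
  show "res (fd_update R l a B) \<in> carrier_mat (2 * l) d"
    unfolding res next_step_def using B' shrink_buffer(1)[OF B'] by (simp add: return_comp_def)
  show "nonzero_rows (res (fd_update R l a B)) < 2 * l"
  proof (cases "res (find_zero_row_c B') = None")
    case True
    then show ?thesis unfolding res next_step_def using shrink_buffer(2)[OF B'] l by simp
  next
    case False
    then obtain z' where "z' < dim_row B'" "row B' z' = 0\<^sub>v (dim_col B')"
      by (auto simp: find_zero_row_c_def split: if_splits)
    then have "{i. i < dim_row B' \<and> row B' i \<noteq> 0\<^sub>v (dim_col B')} \<subset> {..<dim_row B'}" by auto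
    then have "nonzero_rows B' < card {..<dim_row B'}"
      unfolding nonzero_rows_def by (intro psubset_card_mono) auto
    moreover have "next_step = return_comp B'" unfolding next_step_def by (rule if_not_P[OF False])
    ultimately show ?thesis using res dims' by (simp add: return_comp_def)
  qed
  show "\<exists>e. shrinks_to d l e (\<lambda>x. gram_form B x + (ip d x (\<lambda>t. a $ t))\<^sup>2)
           (sq_frobenius B + ip d (\<lambda>t. a $ t) (\<lambda>t. a $ t))
           (gram_form (res (fd_update R l a B))) (sq_frobenius (res (fd_update R l a B)))"
    unfolding res next_step_def gram'[symmetric] frob'[symmetric]
    using shrink_buffer(3)[OF B']
    by (cases "res (find_zero_row_c B')")
      (simp_all add: return_comp_def, rule exI, rule shrinks_to_refl)
  show "l * time (fd_update R l a B) + (nonzero_rows (res (fd_update R l a B)) - l) * shrink_time R l d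
      \<le> l * (6 * l * d) + (nonzero_rows B - l + 1) * shrink_time R l d"
  proof (cases "res (find_zero_row_c B') = None")
    case True
    \<comment> \<open>A buffer that is full after the insertion had at least
      \<open>2 * l - 1\<close> nonzero rows before it. The potential together with the unit for this
      insertion thus reaches \<open>l\<close>, enough for \<open>l\<close> times the cost of a
      shrinking step.\<close>
    have "2 * l \<le> nonzero_rows B + 1"
      using find_zero_row_None[OF True] nz' dims' by simp
    then have "l * shrink_time R l d \<le> (nonzero_rows B - l + 1) * shrink_time R l d"
      by (intro mult_right_mono) auto
    then show ?thesis
      unfolding time res next_step_def using True shrink_buffer(2)[OF B'] shrink_buffer(5)[OF B']
      by (simp add: distrib_left)
  next
    case False
    have "(nonzero_rows B' - l) * shrink_time R l d \<le> (nonzero_rows B - l + 1) * shrink_time R l d"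
      using nz' by (intro mult_right_mono) auto
    moreover have "next_step = return_comp B'" unfolding next_step_def by (rule if_not_P[OF False])
    ultimately show ?thesis
      unfolding time res by (simp add: return_comp_def distrib_left)
  qed
  show "mem (fd_update R l a B) \<le> 2 * l * d + shrink_mem R l d"
  proof -
    have "mem next_step \<le> shrink_mem R l d"
      unfolding next_step_def using shrink_buffer(6)[OF B'] by (simp add: return_comp_def)
    then show ?thesis using mem by linarith
  qed
qed

text \<open>The potential inequalities telescope along the stream. Time is multiplied by
  \<open>l\<close> because each insertion pays one \<open>l\<close>-th of a shrinking step. The
  memory bound counts the old buffer, the new buffer, the arriving row and one shrinking
  step.\<close>

lemma stream_fold_buffer:
  assumes "B \<in> carrier_mat (2 * l) d" "nonzero_rows B < 2 * l" "set as \<subseteq> carrier_vec d"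
  shows "res (stream_fold (fd_update R l) as B) \<in> carrier_mat (2 * l) d \<and>
    (\<exists>e. shrinks_to d l e (\<lambda>x. gram_form B x + (\<Sum>a\<leftarrow>as. (ip d x (\<lambda>t. a $ t))\<^sup>2))
       (sq_frobenius B + (\<Sum>a\<leftarrow>as. ip d (\<lambda>t. a $ t) (\<lambda>t. a $ t)))
       (gram_form (res (stream_fold (fd_update R l) as B)))
       (sq_frobenius (res (stream_fold (fd_update R l) as B)))) \<and>
    l * time (stream_fold (fd_update R l) as B) \<le>
      length as * (l * (6 * l * d + d)) + (nonzero_rows B - l + length as) * shrink_time R l d \<and>
    mem (stream_fold (fd_update R l) as B) \<le> 4 * l * d + d + shrink_mem R l d"
  using assms
proof (induction as arbitrary: B)
  case Nil
  then show ?case by (auto simp: reals_stored_simps intro!: exI shrinks_to_refl)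
next
  case (Cons a as)
  have a: "a \<in> carrier_vec d" using Cons.prems by simp
  note step = fd_update_buffer[OF Cons.prems(1,2) a]
  define B' where "B' = res (fd_update R l a B)"
  define F where "F = stream_fold (fd_update R l) as B'"
  have IH: "res F \<in> carrier_mat (2 * l) d"
    "\<exists>e. shrinks_to d l e (\<lambda>x. gram_form B' x + (\<Sum>a\<leftarrow>as. (ip d x (\<lambda>t. a $ t))\<^sup>2))
       (sq_frobenius B' + (\<Sum>a\<leftarrow>as. ip d (\<lambda>t. a $ t) (\<lambda>t. a $ t))) (gram_form (res F)) (sq_frobenius (res F))"
    "l * time F \<le> length as * (l * (6 * l * d + d)) + (nonzero_rows B' - l + length as) * shrink_time R l d"
    "mem F \<le> 4 * l * d + d + shrink_mem R l d"
    using Cons.IH[OF step(1,2)] Cons.prems(3) by (auto simp: F_def B'_def)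
  have fold: "res (stream_fold (fd_update R l) (a # as) B) = res F"
    "time (stream_fold (fd_update R l) (a # as) B) = d + time (fd_update R l a B) + time F"
    "mem (stream_fold (fd_update R l) (a # as) B) = max (2 * l * d + d + mem (fd_update R l a B)) (mem F)"
    using a Cons.prems(1) by (auto simp: Let_def F_def B'_def reals_stored_simps)
  obtain e e' where
    e: "shrinks_to d l e (\<lambda>x. gram_form B x + (ip d x (\<lambda>t. a $ t))\<^sup>2)
       (sq_frobenius B + ip d (\<lambda>t. a $ t) (\<lambda>t. a $ t)) (gram_form B') (sq_frobenius B')" and
    e': "shrinks_to d l e' (\<lambda>x. gram_form B' x + (\<Sum>a\<leftarrow>as. (ip d x (\<lambda>t. a $ t))\<^sup>2))
       (sq_frobenius B' + (\<Sum>a\<leftarrow>as. ip d (\<lambda>t. a $ t) (\<lambda>t. a $ t))) (gram_form (res F)) (sq_frobenius (res F))"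
    using step(3) IH(2) by (auto simp: B'_def)
  have "shrinks_to d l (e + e') (\<lambda>x. gram_form B x + (\<Sum>a\<leftarrow>a # as. (ip d x (\<lambda>t. a $ t))\<^sup>2))
       (sq_frobenius B + (\<Sum>a\<leftarrow>a # as. ip d (\<lambda>t. a $ t) (\<lambda>t. a $ t))) (gram_form (res F)) (sq_frobenius (res F))"
    using shrinks_to_trans[OF shrinks_to_add[OF e] e'] by (simp add: add.assoc)
  moreover have "l * (d + time (fd_update R l a B) + time F) \<le>
      length (a # as) * (l * (6 * l * d + d)) + (nonzero_rows B - l + length (a # as)) * shrink_time R l d"
    using step(4) IH(3) unfolding B'_def[symmetric] by (simp add: algebra_simps)
  moreover have "max (2 * l * d + d + mem (fd_update R l a B)) (mem F) \<le> 4 * l * d + d + shrink_mem R l d"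
    using IH(4) step(5) by (intro max.boundedI) linarith+
  ultimately show ?case
    unfolding fold using IH(1) by blast
qed

text \<open>The zero buffer starts with form, norm and potential 0. The accumulated loss
  \<open>e\<close> satisfies \<open>l * e \<le> \<phi>\<close> because the squared Frobenius norm of
  the final buffer is nonnegative. The last shrinking step clears the rows from index
  \<open>l\<close> on, so truncation keeps the form.\<close>

lemma fd_sketch_correct:
  assumes as: "set as \<subseteq> carrier_vec d"
  defines "At \<equiv> res (fd_sketch R l d as)" and "\<phi> \<equiv> (\<Sum>a\<leftarrow>as. ip d (\<lambda>t. a $ t) (\<lambda>t. a $ t))"
  shows "At \<in> carrier_mat l d"
    and "gram_form At x \<le> (\<Sum>a\<leftarrow>as. (ip d x (\<lambda>t. a $ t))\<^sup>2)"
    and "(\<Sum>a\<leftarrow>as. (ip d x (\<lambda>t. a $ t))\<^sup>2) \<le> gram_form At x + \<phi> / real l * ip d x x"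
    and "l * time (fd_sketch R l d as) \<le> l * (3 * l * d) + length as * (l * (6 * l * d + d))
           + (length as + l) * shrink_time R l d"
    and "mem (fd_sketch R l d as) \<le> 8 * l * d + d + shrink_mem R l d"
proof -
  define B0 :: "real mat" where "B0 = mat (2 * l) d (\<lambda>_. 0)"
  define F where "F = stream_fold (fd_update R l) as B0"
  define B2 where "B2 = res (shrink R l (res F))"
  have B0: "B0 \<in> carrier_mat (2 * l) d" by (simp add: B0_def)
  have "{i. i < dim_row B0 \<and> row B0 i \<noteq> 0\<^sub>v (dim_col B0)} = {}"
    by (auto simp: B0_def intro!: eq_vecI)
  then have nz0: "nonzero_rows B0 = 0" by (simp add: nonzero_rows_def)
  have F: "res F \<in> carrier_mat (2 * l) d"
    "\<exists>e. shrinks_to d l e (\<lambda>x. gram_form B0 x + (\<Sum>a\<leftarrow>as. (ip d x (\<lambda>t. a $ t))\<^sup>2))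
       (sq_frobenius B0 + \<phi>) (gram_form (res F)) (sq_frobenius (res F))"
    "l * time F \<le> length as * (l * (6 * l * d + d)) + length as * shrink_time R l d"
    "mem F \<le> 4 * l * d + d + shrink_mem R l d"
    using stream_fold_buffer[OF B0 _ as] nz0 l by (auto simp: F_def \<phi>_def)
  have gram0: "gram_form B0 = (\<lambda>x. 0)" and frob0: "sq_frobenius B0 = 0"
    by (auto simp: gram_form_def sq_frobenius_def ip_def B0_def)
  have B2: "B2 \<in> carrier_mat (2 * l) d" using shrink_buffer(1)[OF F(1)] by (simp add: B2_def)
  have At: "At = mat l d (\<lambda>(i, j). B2 $$ (i, j))"
    by (simp add: At_def fd_sketch_def res_bind_comp B2_def F_def B0_def mat_c_def)
  show "At \<in> carrier_mat l d" by (simp add: At)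
  have gram_At: "gram_form At x = gram_form B2 x" for x
  proof -
    have "(\<Sum>i<2 * l. (ip d x (row_fun B2 i))\<^sup>2) = (\<Sum>i<l. (ip d x (row_fun At i))\<^sup>2)"
      by (rule sum.mono_neutral_cong_right)
        (auto simp: At ip_def B2_def shrink_buffer(4)[OF F(1)])
    then show ?thesis using B2 by (simp add: gram_form_def At)
  qed
  obtain e where e: "shrinks_to d l e (\<lambda>x. \<Sum>a\<leftarrow>as. (ip d x (\<lambda>t. a $ t))\<^sup>2) \<phi> (gram_form B2) (sq_frobenius B2)"
  proof -
    obtain e1 e2 where "shrinks_to d l e1 (\<lambda>x. \<Sum>a\<leftarrow>as. (ip d x (\<lambda>t. a $ t))\<^sup>2) \<phi>
        (gram_form (res F)) (sq_frobenius (res F))"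
      "shrinks_to d l e2 (gram_form (res F)) (sq_frobenius (res F)) (gram_form B2) (sq_frobenius B2)"
      using F(2) shrink_buffer(3)[OF F(1)] by (auto simp: gram0 frob0 B2_def)
    then show ?thesis by (intro that[of "e1 + e2"]) (rule shrinks_to_trans)
  qed
  have "real l * e \<le> \<phi>" using e sq_frobenius_nonneg[of B2] by (simp add: shrinks_to_def)
  then have el: "e \<le> \<phi> / real l" using l by (simp add: field_simps)
  show "gram_form At x \<le> (\<Sum>a\<leftarrow>as. (ip d x (\<lambda>t. a $ t))\<^sup>2)"
    using e by (simp add: gram_At shrinks_to_def)
  have "(\<Sum>a\<leftarrow>as. (ip d x (\<lambda>t. a $ t))\<^sup>2) \<le> gram_form At x + e * ip d x x"
    using e by (simp add: gram_At shrinks_to_def)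
  also have "\<dots> \<le> gram_form At x + \<phi> / real l * ip d x x"
    using el ip_nonneg by (intro add_left_mono mult_right_mono)
  finally show "(\<Sum>a\<leftarrow>as. (ip d x (\<lambda>t. a $ t))\<^sup>2) \<le> gram_form At x + \<phi> / real l * ip d x x" .
  \<comment> \<open>Creating the buffer takes \<open>2 * l * d\<close> units, and copying its first
    \<open>l\<close> rows takes \<open>l * d\<close>.\<close>
  have "time (fd_sketch R l d as) = 3 * l * d + time F + shrink_time R l d"
    using shrink_buffer(5)[OF F(1)]
    by (simp add: fd_sketch_def time_bind_comp mat_c_def B0_def[symmetric] F_def[symmetric])
  then show "l * time (fd_sketch R l d as) \<le> l * (3 * l * d) + length as * (l * (6 * l * d + d))
           + (length as + l) * shrink_time R l d"
    using F(3) by (simp add: algebra_simps)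
  have "0 + mem (fd_sketch R l d as) \<le> 8 * l * d + d + shrink_mem R l d"
    unfolding fd_sketch_def
    apply (intro mem_bind_comp_leI)
    using F(1,4) B0 B2 shrink_buffer(6)[OF F(1)]
       apply (simp_all add: mat_c_def B0_def[symmetric] F_def[symmetric] B2_def[symmetric] reals_stored_simps)
     apply (simp_all add: ac_simps)
    done
  then show "mem (fd_sketch R l d as) \<le> 8 * l * d + d + shrink_mem R l d" by simp
qed

end

section \<open>Accuracy and cost of the two passes\<close>

text \<open>The size of \<open>l\<close> makes the loss at most half of the gap \<open>g\<close>. By
  Weyl's inequality the first \<open>k\<close> values of \<beta> stay at or above
  \<open>p - g / 2\<close>, and the others at or below \<open>p - g\<close>. Cutting off after the
  first \<open>k\<close> indices, with value 1 or with the reciprocal eigenvalue, is therefore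
  Lipschitz between the two spectra.\<close>

lemma spectral_gap_scores:
  fixes \<alpha> \<beta> :: "nat \<Rightarrow> real" and \<epsilon> \<Delta> \<phi> :: real and l :: nat
  assumes v: "orthonormal d d v" and complete: "\<forall>a. \<forall>t<d. a t = (\<Sum>i<d. ip d a (v i) * v i t)"
    and w: "orthonormal d r w"
    and \<alpha>: "\<And>i. 0 \<le> \<alpha> i" "\<forall>j<d. \<forall>i\<le>j. \<alpha> j \<le> \<alpha> i" "0 < \<alpha> 0"
    and \<beta>: "\<And>i. 0 \<le> \<beta> i" "\<forall>j<r. \<forall>i\<le>j. \<beta> j \<le> \<beta> i"
    and k: "1 \<le> k" "k < d" "k \<le> r" and \<Delta>: "0 < \<Delta>" and \<epsilon>: "0 < \<epsilon>"
    and gap: "\<Delta> * \<alpha> 0 \<le> \<alpha> (k - 1) - \<alpha> k"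
    and \<phi>: "\<phi> = (\<Sum>i<d. \<alpha> i)" "\<phi> \<le> 10 * real k * \<alpha> 0"
    and l: "1 \<le> l" "20 * real k \<le> \<Delta> * real l"
      "160000 * (real k * (\<alpha> 0 / \<alpha> (k - 1)))\<^sup>2 \<le> (\<epsilon> * \<Delta>)\<^sup>2 * real l"
    and lower: "\<And>x. (\<Sum>j<r. \<beta> j * (ip d x (w j))\<^sup>2) \<le> (\<Sum>i<d. \<alpha> i * (ip d x (v i))\<^sup>2)"
    and upper: "\<And>x. (\<Sum>i<d. \<alpha> i * (ip d x (v i))\<^sup>2) \<le>
      (\<Sum>j<r. \<beta> j * (ip d x (w j))\<^sup>2) + \<phi> / real l * ip d x x"
  shows "\<And>j. j < k \<Longrightarrow> 0 < \<beta> j"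
    and "\<bar>(\<Sum>i<k. (ip d a (v i))\<^sup>2) - (\<Sum>j<k. (ip d a (w j))\<^sup>2)\<bar> \<le> \<epsilon> * ip d a a"
    and "\<bar>(\<Sum>i<k. (ip d a (v i))\<^sup>2 / \<alpha> i) - (\<Sum>j<k. (ip d a (w j))\<^sup>2 / \<beta> j)\<bar>
      \<le> \<epsilon> * real k * ip d a a / \<phi>"
proof -
  note complete = complete[rule_format]
  note \<alpha> = \<alpha>(1) \<alpha>(2)[rule_format, rotated] \<alpha>(3)
  note \<beta> = \<beta>(1) \<beta>(2)[rule_format, rotated]
  define g p where "g = \<Delta> * \<alpha> 0" and "p = \<alpha> (k - 1)"
  have g: "0 < g" using \<Delta> \<alpha>(3) by (simp add: g_def)
  have gp: "g \<le> p" using gap \<alpha>(1)[of k] by (simp add: g_def p_def)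
  have p0: "p \<le> \<alpha> 0" using \<alpha>(2)[of 0 "k - 1"] k by (simp add: p_def)
  have \<phi>0: "0 < \<phi>"
    unfolding \<phi>(1) by (rule sum_pos2[of _ 0]) (use \<alpha> k in auto)
  have e: "0 < \<phi> / real l" using \<phi>0 l(1) by simp
  have e_le: "\<phi> / real l \<le> g / 2"
  proof -
    have "2 * \<phi> \<le> 20 * real k * \<alpha> 0" using \<phi>(2) by simp
    also have "\<dots> \<le> \<Delta> * real l * \<alpha> 0" using l(2) \<alpha>(3) by (intro mult_right_mono) auto
    finally show ?thesis using l(1) by (simp add: g_def field_simps)
  qed
  have \<alpha>_top: "p \<le> \<alpha> i" if "i < k" for i using \<alpha>(2)[of i "k - 1"] that k by (simp add: p_def)
  have \<alpha>_tail: "\<alpha> i \<le> p - g" if "k \<le> i" "i < d" for i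
    using \<alpha>(2)[of k i] gap that by (simp add: p_def g_def)
  have "p \<le> \<beta> (k - 1) + \<phi> / real l"
    unfolding p_def
    by (rule Weyl_inequality[OF v w _ _ _ _ _ _ upper]) (use k \<alpha> \<beta> in auto)
  then have \<beta>_top: "p - g / 2 \<le> \<beta> j" if "j < k" for j
    using \<beta>(2)[of j "k - 1"] that k e_le by linarith
  have \<beta>_half: "p / 2 \<le> \<beta> j" if "j < k" for j using \<beta>_top[OF that] gp by simp
  have \<beta>_tail: "\<beta> j \<le> p - g" if "k \<le> j" "j < r" for j
  proof (cases "j < d")
    case True
    \<comment> \<open>The roles are exchanged and \<open>e = 0\<close>, because the form of \<beta>
      lies below that of \<alpha>.\<close>
    have "\<beta> j \<le> \<alpha> j + 0"
      by (rule Weyl_inequality[OF w v]) (use that True \<alpha> \<beta> lower in auto)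
    then show ?thesis using \<alpha>_tail[OF that(1) True] by simp
  next
    case False
    \<comment> \<open>An index from \<open>d\<close> on has no partner among the eigenvalues
      \<alpha>; monotonicity reduces it to index \<open>k\<close>.\<close>
    have "\<beta> j \<le> \<beta> k" using \<beta>(2)[of k j] that by simp
    also have "\<beta> k \<le> \<alpha> k + 0"
      by (rule Weyl_inequality[OF w v]) (use that k \<alpha> \<beta> lower in auto)
    finally show ?thesis using gap by (simp add: g_def p_def)
  qed
  show \<beta>_pos: "0 < \<beta> j" if "j < k" for j using \<beta>_half[OF that] g gp by simp
  have f_restrict: "(\<Sum>i<N. (if i < k then f i else 0) * x i) = (\<Sum>i<k. f i * x i)"
    if "k \<le> N" for N and f x :: "nat \<Rightarrow> real"
    by (rule sum.mono_neutral_cong_right) (use that in auto)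
  \<comment> \<open>A top \<alpha> exceeds a tail \<beta> by at least \<open>g\<close>. A top
    \<beta> may have dropped by \<open>g / 2\<close>, which leaves \<open>g / 2\<close> above a tail
    \<alpha>.\<close>
  have diff_gap: "g / 2 \<le> \<bar>\<alpha> i - \<beta> j\<bar>" if "i < d" "j < r" "i < k \<longleftrightarrow> \<not> j < k" for i j
    using \<alpha>_top[of i] \<alpha>_tail[of i] \<beta>_top[of j] \<beta>_tail[of j] that g by (cases "i < k") auto
  \<comment> \<open>With loss \<open>\<phi> / l\<close> and trace \<phi> the perturbation bound is
    \<open>(K * \<phi>)^2 / l\<close>; it remains to bring this below \<open>c^2\<close>.\<close>
  have conclude: "\<bar>X\<bar> \<le> c * ip d a a"
    if "X\<^sup>2 \<le> (ip d a a)\<^sup>2 * (K\<^sup>2 * (\<phi> / real l * (\<Sum>i<d. \<alpha> i)))" "0 \<le> c" "(K * \<phi>)\<^sup>2 \<le> c\<^sup>2 * real l"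
    for X K c
  proof -
    have "K\<^sup>2 * (\<phi> / real l * (\<Sum>i<d. \<alpha> i)) = (K * \<phi>)\<^sup>2 / real l"
      by (simp add: \<phi>(1)[symmetric] power2_eq_square)
    also have "\<dots> \<le> c\<^sup>2" using that(3) l(1) by (simp add: divide_le_eq)
    finally have "X\<^sup>2 \<le> (ip d a a)\<^sup>2 * c\<^sup>2"
      using that(1) by (meson mult_left_mono order_trans zero_le_power2)
    then have "X\<^sup>2 \<le> (c * ip d a a)\<^sup>2" by (simp add: power_mult_distrib mult.commute)
    then show ?thesis using that(2) ip_nonneg[of d a] abs_le_square_iff[of X "c * ip d a a"] by simp
  qed

  \<comment> \<open>The indicator of the top \<open>k\<close> indices changes only across the cut,
    by 1, where eigenvalues differ by at least \<open>g / 2\<close>. Hence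
    \<open>K = 2 / g\<close>.\<close>
  have "((\<Sum>i<d. (if i < k then 1 else 0) * (ip d a (v i))\<^sup>2) -
      (\<Sum>j<r. (if j < k then 1 else 0) * (ip d a (w j))\<^sup>2))\<^sup>2 \<le>
    (ip d a a)\<^sup>2 * ((2 / g)\<^sup>2 * (\<phi> / real l * (\<Sum>i<d. \<alpha> i)))"
  proof (rule spectral_function_perturbation[OF v complete w e \<beta>(1) lower upper])
    fix i j assume ij: "i < d" "j < r"
    show "\<bar>(if i < k then 1 else 0) - (if j < k then 1 else 0)\<bar> \<le> 2 / g * \<bar>\<alpha> i - \<beta> j\<bar>"
    proof (cases "i < k \<longleftrightarrow> j < k")
      case False
      then show ?thesis using diff_gap[OF ij] g by (auto simp: field_simps)
    qed (use g in auto)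
  next
    fix i assume "i < d"
    show "\<bar>if i < k then 1 else 0\<bar> \<le> 2 / g * \<bar>\<alpha> i\<bar>"
      using \<alpha>_top[of i] gp g by (auto simp: field_simps)
  qed
  then have T: "((\<Sum>i<k. (ip d a (v i))\<^sup>2) - (\<Sum>j<k. (ip d a (w j))\<^sup>2))\<^sup>2 \<le>
      (ip d a a)\<^sup>2 * ((2 / g)\<^sup>2 * (\<phi> / real l * (\<Sum>i<d. \<alpha> i)))"
    using k by (simp add: f_restrict)
  show "\<bar>(\<Sum>i<k. (ip d a (v i))\<^sup>2) - (\<Sum>j<k. (ip d a (w j))\<^sup>2)\<bar> \<le> \<epsilon> * ip d a a"
  proof (rule conclude[OF T])
    show "0 \<le> \<epsilon>" using \<epsilon> by simp
    have "2 / g * \<phi> \<le> 2 / g * (10 * real k * \<alpha> 0)" using \<phi>(2) g by (intro mult_left_mono) auto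
    also have "\<dots> = 20 * real k / \<Delta>" using \<alpha>(3) by (simp add: g_def)
    finally have "(2 / g * \<phi>)\<^sup>2 \<le> (20 * real k / \<Delta>)\<^sup>2" using g \<phi>0 by (intro power_mono) auto
    \<comment> \<open>The projection distance asks only for \<open>400 * k^2 / \<Delta>^2\<close>.
      Since \<open>\<alpha> 0 / p\<close> is at least 1, the stronger requirement of the leverage
      scores covers it.\<close>
    also have "\<dots> \<le> 160000 * (real k * (\<alpha> 0 / p))\<^sup>2 / \<Delta>\<^sup>2"
    proof -
      have "1 \<le> \<alpha> 0 / p" using p0 g gp by simp
      then have "real k \<le> real k * (\<alpha> 0 / p)" using mult_left_mono[of 1 "\<alpha> 0 / p" "real k"] by simp
      then have "(real k)\<^sup>2 \<le> (real k * (\<alpha> 0 / p))\<^sup>2" by (intro power_mono) auto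
      then have "400 * (real k)\<^sup>2 \<le> 160000 * (real k * (\<alpha> 0 / p))\<^sup>2"
        using zero_le_power2[of "real k * (\<alpha> 0 / p)"] by linarith
      from divide_right_mono[OF this zero_le_power2, of \<Delta>] show ?thesis
        by (simp only: power_divide power_mult_distrib[of 20]) simp
    qed
    also have "\<dots> \<le> \<epsilon>\<^sup>2 * real l"
      using l(3) \<Delta> by (simp add: p_def pos_divide_le_eq power_mult_distrib ac_simps)
    finally show "(2 / g * \<phi>)\<^sup>2 \<le> \<epsilon>\<^sup>2 * real l" .
  qed

  \<comment> \<open>Across the cut the truncated reciprocals differ by at most \<open>2 / p\<close>,
    which is \<open>K * (g / 2)\<close> for \<open>K = 4 / (g * p)\<close>.\<close>
  have "((\<Sum>i<d. (if i < k then 1 / \<alpha> i else 0) * (ip d a (v i))\<^sup>2) -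
      (\<Sum>j<r. (if j < k then 1 / \<beta> j else 0) * (ip d a (w j))\<^sup>2))\<^sup>2 \<le>
    (ip d a a)\<^sup>2 * ((4 / (g * p))\<^sup>2 * (\<phi> / real l * (\<Sum>i<d. \<alpha> i)))"
  proof (rule spectral_function_perturbation[OF v complete w e \<beta>(1) lower upper])
    have p: "0 < p" using g gp by simp
    have inv\<alpha>: "1 / \<alpha> i \<le> 1 / p" "0 < \<alpha> i" if "i < k" for i
      using \<alpha>_top[OF that] p by (auto intro: divide_left_mono)
    have inv\<beta>: "1 / \<beta> j \<le> 2 / p" if "j < k" for j
      using \<beta>_half[OF that] \<beta>_pos[OF that] p by (simp add: field_simps)
    fix i j assume ij: "i < d" "j < r"
    show "\<bar>(if i < k then 1 / \<alpha> i else 0) - (if j < k then 1 / \<beta> j else 0)\<bar> \<le> 4 / (g * p) * \<bar>\<alpha> i - \<beta> j\<bar>"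
    proof (cases "i < k \<longleftrightarrow> j < k")
      case False
      have "\<bar>(if i < k then 1 / \<alpha> i else 0) - (if j < k then 1 / \<beta> j else 0)\<bar> \<le> 2 / p"
        using False inv\<alpha>[of i] inv\<beta>[of j] \<beta>_pos[of j] p
        by (cases "i < k") (auto simp: divide_right_mono intro: order_trans)
      also have "\<dots> = 4 / (g * p) * (g / 2)" using g by simp
      also have "\<dots> \<le> 4 / (g * p) * \<bar>\<alpha> i - \<beta> j\<bar>"
        using diff_gap[OF ij] False g p by (intro mult_left_mono) auto
      finally show ?thesis .
    next
      case same: True
      show ?thesis
      proof (cases "i < k")
        case True
        then have j: "j < k" using same by simp
        have "\<bar>1 / \<alpha> i - 1 / \<beta> j\<bar> = (1 / \<alpha> i) * (1 / \<beta> j) * \<bar>\<alpha> i - \<beta> j\<bar>"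
        proof -
          have "1 / \<alpha> i - 1 / \<beta> j = (1 / \<alpha> i) * (1 / \<beta> j) * (\<beta> j - \<alpha> i)"
            using inv\<alpha>(2)[OF True] \<beta>_pos[OF j] by (simp add: field_simps)
          then show ?thesis
            using inv\<alpha>(2)[OF True] \<beta>_pos[OF j] by (simp add: abs_mult abs_minus_commute)
        qed
        \<comment> \<open>One of the two factors \<open>1 / p\<close> is weakened to
          \<open>1 / g\<close>, as \<open>g \<le> p\<close>, so that the constant \<open>K\<close>
          also fits on the same side of the cut.\<close>
        also have "\<dots> \<le> (1 / g) * (2 / p) * \<bar>\<alpha> i - \<beta> j\<bar>"
        proof (intro mult_right_mono mult_mono inv\<beta>[OF j])
          show "1 / \<alpha> i \<le> 1 / g" using \<alpha>_top[OF True] gp g by (simp add: frac_le)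
        qed (use g p \<beta>_pos[OF j] in auto)
        also have "\<dots> \<le> 4 / (g * p) * \<bar>\<alpha> i - \<beta> j\<bar>"
          using g p by (intro mult_right_mono) (auto simp: divide_right_mono)
        finally show ?thesis using True j by simp
      qed (use same g p in auto)
    qed
  next
    fix i assume "i < d"
    show "\<bar>if i < k then 1 / \<alpha> i else 0\<bar> \<le> 4 / (g * p) * \<bar>\<alpha> i\<bar>"
    proof (cases "i < k")
      case True
      have "1 / \<alpha> i \<le> 1 / p" using \<alpha>_top[OF True] g gp by (intro divide_left_mono) auto
      also have "\<dots> \<le> 4 / p" using g gp by (intro divide_right_mono) auto
      also have "\<dots> = 4 / (g * p) * g" using g by simp
      also have "\<dots> \<le> 4 / (g * p) * \<alpha> i" using \<alpha>_top[OF True] g gp by (intro mult_left_mono) auto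
      finally show ?thesis using True \<alpha>(1)[of i] by simp
    qed (use g gp \<alpha>(1)[of i] in auto)
  qed
  then have L: "((\<Sum>i<k. (ip d a (v i))\<^sup>2 / \<alpha> i) - (\<Sum>j<k. (ip d a (w j))\<^sup>2 / \<beta> j))\<^sup>2 \<le>
      (ip d a a)\<^sup>2 * ((4 / (g * p))\<^sup>2 * (\<phi> / real l * (\<Sum>i<d. \<alpha> i)))"
    using k by (simp add: f_restrict)
  have "\<bar>(\<Sum>i<k. (ip d a (v i))\<^sup>2 / \<alpha> i) - (\<Sum>j<k. (ip d a (w j))\<^sup>2 / \<beta> j)\<bar>
      \<le> (\<epsilon> * real k / \<phi>) * ip d a a"
  proof (rule conclude[OF L])
    show "0 \<le> \<epsilon> * real k / \<phi>" using \<epsilon> \<phi>0 by simp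
    \<comment> \<open>Here 400 is \<open>4 * 10^2\<close>, and its square is the constant 160000.
      One factor \<open>k\<close> is split off and absorbed by the \<open>k\<close> in the error
      bound, so \<open>l\<close> of order \<open>k^2\<close> is enough. The second factor \<phi>
      clears the denominator of that bound.\<close>
    have "4 / (g * p) * \<phi>\<^sup>2 \<le> 4 / (g * p) * (10 * real k * \<alpha> 0)\<^sup>2"
      using \<phi>(2) \<phi>0 g gp by (intro mult_left_mono power_mono) auto
    also have "\<dots> = 400 * real k * (real k * (\<alpha> 0 / p)) / \<Delta>"
      using \<alpha>(3) g gp by (simp add: g_def power2_eq_square ac_simps)
    finally have "(4 / (g * p) * \<phi>\<^sup>2)\<^sup>2 \<le> (400 * real k * (real k * (\<alpha> 0 / p)) / \<Delta>)\<^sup>2"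
      using g gp by (intro power_mono) auto
    also have "\<dots> = (real k)\<^sup>2 * (160000 * (real k * (\<alpha> 0 / p))\<^sup>2 / \<Delta>\<^sup>2)"
      by (simp add: power_mult_distrib power_divide)
    also have "\<dots> \<le> (real k)\<^sup>2 * (\<epsilon>\<^sup>2 * real l)"
      using l(3) \<Delta> by (intro mult_left_mono) (simp_all add: p_def pos_divide_le_eq power_mult_distrib ac_simps)
    finally have "(4 / (g * p) * \<phi>\<^sup>2)\<^sup>2 / \<phi>\<^sup>2 \<le> (real k)\<^sup>2 * (\<epsilon>\<^sup>2 * real l) / \<phi>\<^sup>2"
      by (intro divide_right_mono) auto
    moreover have "(4 / (g * p) * \<phi>\<^sup>2)\<^sup>2 / \<phi>\<^sup>2 = (4 / (g * p) * \<phi>)\<^sup>2"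
      using \<phi>0 by (simp add: power2_eq_square)
    ultimately show "(4 / (g * p) * \<phi>)\<^sup>2 \<le> (\<epsilon> * real k / \<phi>)\<^sup>2 * real l"
      by (simp add: power_mult_distrib power_divide ac_simps)
  qed
  then show "\<bar>(\<Sum>i<k. (ip d a (v i))\<^sup>2 / \<alpha> i) - (\<Sum>j<k. (ip d a (w j))\<^sup>2 / \<beta> j)\<bar>
      \<le> \<epsilon> * real k * ip d a a / \<phi>"
    by simp
qed

section \<open>Values and cost of the second pass\<close>

lemma res_row_scores_eq:
  assumes a: "a \<in> carrier_vec d" and W: "W \<in> carrier_mat d r" and k: "k \<le> r"
  shows "res (row_scores (vec k f) (mat d k (\<lambda>(i, j). W $$ (i, j))) a) =
    (ip d (\<lambda>t. a $ t) (\<lambda>t. a $ t) - (\<Sum>j<k. (ip d (\<lambda>t. a $ t) (col_fun W j))\<^sup>2),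
     \<Sum>j<k. (ip d (\<lambda>t. a $ t) (col_fun W j))\<^sup>2 / (f j)\<^sup>2)"
proof -
  define Vk where "Vk = mat d k (\<lambda>(i, j). W $$ (i, j))"
  define y where "y j = ip d (\<lambda>t. a $ t) (col_fun W j)" for j
  have Vk: "Vk \<in> carrier_mat d k" by (simp add: Vk_def)
  have Vy: "transpose_mat Vk *\<^sub>v a = vec k y"
    by (rule eq_vecI) (use a in \<open>auto simp: Vk_def y_def ip_def scalar_prod_def atLeast0LessThan mult.commute\<close>)
  have Si: "mat k k (\<lambda>(i, j). if i = j then 1 / vec k f $ j else 0) *\<^sub>v vec k y = vec k (\<lambda>j. y j / f j)"
  proof (rule eq_vecI)
    fix i assume "i < dim_vec (vec k (\<lambda>j. y j / f j))"
    then have i: "i < k" by simp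
    then have "(mat k k (\<lambda>(i, j). if i = j then 1 / vec k f $ j else 0) *\<^sub>v vec k y) $ i =
        (\<Sum>j<k. (if i = j then 1 / f j else 0) * y j)"
      by (simp add: scalar_prod_def atLeast0LessThan cong: if_cong)
    also have "\<dots> = (\<Sum>j<k. if j = i then y j / f j else 0)" by (rule sum.cong) auto
    finally show "(mat k k (\<lambda>(i, j). if i = j then 1 / vec k f $ j else 0) *\<^sub>v vec k y) $ i =
        vec k (\<lambda>j. y j / f j) $ i" using i by simp
  qed simp
  \<comment> \<open>The product of \<open>a\<close> with \<open>Vk y\<close> is the squared norm of
    \<open>y\<close>, because \<open>y\<close> is itself \<open>Vk^T a\<close>.\<close>
  have "a \<bullet> (Vk *\<^sub>v vec k y) = (\<Sum>t<d. \<Sum>j<k. y j * (a $ t * W $$ (t, j)))"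
    using a by (simp add: Vk_def scalar_prod_def atLeast0LessThan sum_distrib_left ac_simps)
  also have "\<dots> = (\<Sum>j<k. (y j)\<^sup>2)"
    by (subst sum.swap) (simp add: y_def ip_def power2_eq_square sum_distrib_left)
  finally have "a \<bullet> (a - Vk *\<^sub>v vec k y) = ip d (\<lambda>t. a $ t) (\<lambda>t. a $ t) - (\<Sum>j<k. (y j)\<^sup>2)"
    using a Vk by (simp add: scalar_prod_minus_distrib[of _ d])
      (simp add: ip_def scalar_prod_def atLeast0LessThan)
  moreover have "vec k (\<lambda>j. y j / f j) \<bullet> vec k (\<lambda>j. y j / f j) = (\<Sum>j<k. (y j)\<^sup>2 / (f j)\<^sup>2)"
    by (simp add: scalar_prod_def atLeast0LessThan power2_eq_square)
  ultimately show ?thesis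
    unfolding Vk_def[symmetric]
    by (simp add: row_scores_def res_bind_comp transpose_c_def mult_vec_c_def Vy mat_c_def Si dot_c_def
        minus_vec_c_def return_comp_def y_def)
qed

lemma time_row_scores:
  assumes "a \<in> carrier_vec d" "sk \<in> carrier_vec k" "Vk \<in> carrier_mat d k"
  shows "time (row_scores sk Vk a) = 5 * d * k + 3 * k * k + 2 * k + 3 * d"
  using assms
  by (simp add: row_scores_def time_bind_comp transpose_c_def mult_vec_c_def mat_c_def dot_c_def
      minus_vec_c_def return_comp_def)

lemma mem_row_scores:
  assumes "a \<in> carrier_vec d" "sk \<in> carrier_vec k" "Vk \<in> carrier_mat d k"
  shows "mem (row_scores sk Vk a) \<le> d * k + 2 * k + k * k + 2 * d + 2"
proof -
  have "0 + mem (row_scores sk Vk a) \<le> d * k + 2 * k + k * k + 2 * d + 2"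
    unfolding row_scores_def
    apply (intro mem_bind_comp_leI)
    using assms apply (simp_all add: transpose_c_def mult_vec_c_def mat_c_def dot_c_def
      minus_vec_c_def return_comp_def reals_stored_simps ac_simps)
    done
  then show ?thesis by simp
qed

lemma res_stream_emit: "res (stream_emit f as) = map (\<lambda>a. res (f a)) as"
  by (induction as) (auto simp: Let_def)

lemma time_stream_emit:
  assumes "\<And>a. a \<in> set as \<Longrightarrow> dim_vec a + time (f a) \<le> T"
  shows "time (stream_emit f as) \<le> length as * T"
  using assms
proof (induction as)
  case (Cons a as)
  have "time (stream_emit f as) \<le> length as * T" using Cons by simp
  moreover have "dim_vec a + time (f a) \<le> T" using Cons.prems by simp
  ultimately show ?case by (simp add: Let_def reals_stored_simps)
qed simp

lemma mem_stream_emit: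
  assumes "\<And>a. a \<in> set as \<Longrightarrow> dim_vec a + mem (f a) \<le> m"
  shows "mem (stream_emit f as) \<le> m"
  using assms by (induction as) (auto simp: Let_def reals_stored_simps)

section \<open>The top singular values and vectors of the sketch\<close>

context
  fixes R :: svd_routine and M Q W :: "real mat" and s :: "real vec" and k :: nat
  assumes svd_M: "svd R M = (Q, s, W)" and is_svd_M: "is_svd M (Q, s, W)"
begin

lemma res_top_svd:
  "res (top_svd R k M) = (vec k (entry0 s), mat (dim_col M) k (\<lambda>(i, j). W $$ (i, j)))"
  using svd_carrier(3)[OF is_svd_M]
  by (simp add: top_svd_def res_bind_comp svd_c_def svd_M vec_c_def mat_c_def return_comp_def)

lemma time_top_svd:
  "time (top_svd R k M) = svd_time R (dim_row M) (dim_col M) + k + dim_col M * k"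
  using svd_carrier(3)[OF is_svd_M]
  by (simp add: top_svd_def time_bind_comp svd_c_def svd_M vec_c_def mat_c_def return_comp_def)

lemma mem_top_svd:
  "mem (top_svd R k M) \<le> svd_work R (dim_row M) (dim_col M)
     + dim_row M * dim_vec s + dim_vec s + dim_col M * dim_vec s + k + dim_col M * k" (is "_ \<le> ?X")
proof -
  have dims: "dim_row W = dim_col M" "dim_col W = dim_vec s" "dim_row Q = dim_row M" "dim_col Q = dim_vec s"
    using svd_carrier[OF is_svd_M] by auto
  have "0 + mem (top_svd R k M) \<le> ?X"
    unfolding top_svd_def
    apply (rule mem_bind_comp_leI)
    subgoal by (simp add: svd_c_def svd_M reals_stored_simps dims)
    unfolding svd_c_def comp.sel svd_M prod.case
    apply (intro mem_bind_comp_leI)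
    apply (simp_all add: vec_c_def mat_c_def return_comp_def reals_stored_simps dims algebra_simps)
    done
  then show ?thesis by simp
qed

end

section \<open>From the stream of rows to the matrix\<close>

lemma sum_list_rows:
  assumes "A \<in> carrier_mat n d"
  shows "(\<Sum>a\<leftarrow>rows A. f a) = (\<Sum>i<n. f (row A i))"
  using assms by (simp add: rows_def interv_sum_list_conv_sum_set_nat atLeast0LessThan o_def)

lemma ip_row:
  assumes "A \<in> carrier_mat n d" "i < n"
  shows "ip d x (\<lambda>t. row A i $ t) = ip d x (row_fun A i)"
  unfolding ip_def by (rule sum.cong) (use assms in auto)

lemma sum_list_rows_form:
  assumes "A \<in> carrier_mat n d"
  shows "(\<Sum>a\<leftarrow>rows A. (ip d x (\<lambda>t. a $ t))\<^sup>2) = gram_form A x"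
  using assms by (simp add: sum_list_rows[OF assms] gram_form_def ip_row[OF assms])

lemma sum_list_rows_sq_frobenius:
  assumes "A \<in> carrier_mat n d"
  shows "(\<Sum>a\<leftarrow>rows A. ip d (\<lambda>t. a $ t) (\<lambda>t. a $ t)) = sq_frobenius A"
  unfolding sum_list_rows[OF assms] sq_frobenius_rows
  using assms by (intro sum.cong) (auto simp: ip_def)

lemma scalar_prod_col:
  assumes "a \<in> carrier_vec d" "V \<in> carrier_mat d m" "j < m"
  shows "a \<bullet> col V j = ip d (\<lambda>t. a $ t) (col_fun V j)"
  using assms by (simp add: scalar_prod_def ip_def atLeast0LessThan)

text \<open>For a square \<open>V\<close> the left inverse \<open>V^T\<close> is also a right
  inverse; the expansion is \<open>V V^T = 1\<close> applied to \<open>a\<close>.\<close>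

lemma orthonormal_columns_complete:
  assumes V: "V \<in> carrier_mat d d" and 1: "transpose_mat V * V = 1\<^sub>m d" and t: "t < d"
  shows "a t = (\<Sum>i<d. ip d a (col_fun V i) * V $$ (t, i))"
proof -
  have VV: "V * transpose_mat V = 1\<^sub>m d"
    by (rule mat_mult_left_right_inverse[OF _ V 1]) (use V in simp)
  have "(\<Sum>i<d. V $$ (u, i) * V $$ (t, i)) = (if u = t then 1 else 0)" if "u < d" for u
  proof -
    have "(\<Sum>i<d. V $$ (u, i) * V $$ (t, i)) = (V * transpose_mat V) $$ (u, t)"
      using V t that by (simp add: scalar_prod_def atLeast0LessThan)
    then show ?thesis using t that by (simp add: VV)
  qed
  then have "(\<Sum>u<d. a u * (\<Sum>i<d. V $$ (u, i) * V $$ (t, i))) = (\<Sum>u<d. if u = t then a u else 0)"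
    by (intro sum.cong) auto
  then have "a t = (\<Sum>u<d. \<Sum>i<d. a u * V $$ (u, i) * V $$ (t, i))"
    using t by (simp add: sum_distrib_left mult.assoc)
  also have "\<dots> = (\<Sum>i<d. ip d a (col_fun V i) * V $$ (t, i))"
    by (subst sum.swap) (simp add: ip_def sum_distrib_right)
  finally show ?thesis .
qed

section \<open>Bounds for the cost of sketching\<close>

lemma shrink_time_le:
  assumes R: "valid_svd_routine c R" and ld: "1 \<le> l" "1 \<le> d"
  shows "real (shrink_time R l d) \<le>
    (2 * max c 0 + 12) * (real l * real d * real (min (2 * l) d))"
proof -
  define r where "r = min (2 * l) d"
  define X where "X = real l * real d * real r"
  have r: "1 \<le> r" using ld by (simp add: r_def)
  have "real (svd_time R (2 * l) d) \<le> c * real (2 * l) * real d * real r"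
    using R by (auto simp: valid_svd_routine_def r_def simp del: of_nat_mult)
  also have "\<dots> = c * (2 * X)" by (simp add: X_def)
  \<comment> \<open>The constant \<open>c\<close> may be any real number, so it is replaced by a
    nonnegative one.\<close>
  also have "\<dots> \<le> max c 0 * (2 * X)" by (intro mult_right_mono) (auto simp: X_def)
  finally have svd: "real (svd_time R (2 * l) d) \<le> max c 0 * (2 * X)" .
  have "r \<le> d * r" "l * r \<le> l * (r * d)" "d * r \<le> l * (d * r)" "1 \<le> d * r"
    using ld r by auto
  moreover have "l * (r * d) = l * (d * r)" by simp
  ultimately have "1 + 4 * r + 2 * l * r + d * r + 4 * l * r * d \<le> 12 * (l * d * r)"
    unfolding mult.assoc by linarith
  then have "real (1 + 4 * r + 2 * l * r + d * r + 4 * l * r * d) \<le> real (12 * (l * d * r))"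
    by (rule of_nat_mono)
  then have "real (1 + 4 * r + 2 * l * r + d * r + 4 * l * r * d) \<le> 12 * X"
    by (simp add: X_def)
  moreover have "real (shrink_time R l d) =
      real (svd_time R (2 * l) d) + real (1 + 4 * r + 2 * l * r + d * r + 4 * l * r * d)"
    by (simp add: shrink_time_def r_def[symmetric] Let_def)
  ultimately show ?thesis
    unfolding r_def[symmetric] X_def[symmetric] using svd by (simp add: algebra_simps)
qed

lemma shrink_mem_le:
  assumes R: "valid_svd_routine c R" and ld: "1 \<le> l" "1 \<le> d"
  shows "real (shrink_mem R l d) \<le> (2 * max c 0 + 13) * (real d * real l)"
proof -
  define r where "r = min (2 * l) d"
  have "real (svd_work R (2 * l) d) \<le> c * real (2 * l) * real d"
    using R by (auto simp: valid_svd_routine_def simp del: of_nat_mult)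
  also have "\<dots> = c * (2 * (real d * real l))" by simp
  also have "\<dots> \<le> max c 0 * (2 * (real d * real l))" by (intro mult_right_mono) auto
  finally have svd: "real (svd_work R (2 * l) d) \<le> max c 0 * (2 * (real d * real l))" .
  have rd: "r \<le> d" and rl: "r \<le> 2 * l" by (auto simp: r_def)
  have bound: "2 * (2 * z + r + y) + 1 + 2 * x \<le> 13 * x"
    if "z \<le> x" "r \<le> x" "1 \<le> x" "y \<le> 2 * x" for x y z :: nat
    using that by simp
  have "l * r \<le> d * l" "r \<le> d * l" "1 \<le> d * l" "d * r \<le> 2 * (d * l)"
    using rd rl ld mult_le_mono2[OF rl, of d] mult_le_mono[OF rd ld(1)] by (auto simp: ac_simps)
  from bound[OF this] have "2 * (2 * l * r + r + d * r) + 1 + 2 * l * d \<le> 13 * (d * l)"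
    by (simp add: ac_simps)
  then have "real (2 * (2 * l * r + r + d * r) + 1 + 2 * l * d) \<le> real (13 * (d * l))"
    by (rule of_nat_mono)
  moreover have "real (shrink_mem R l d) =
      real (svd_work R (2 * l) d) + real (2 * (2 * l * r + r + d * r) + 1 + 2 * l * d)"
    by (simp add: shrink_mem_def r_def[symmetric] Let_def)
  ultimately show ?thesis using svd by (simp add: algebra_simps)
qed

text \<open>The minimum in \<open>shrink_time_le\<close> is used in two ways. In the
  \<open>n\<close> amortised shares, each one \<open>l\<close>-th of a shrinking step, it is bounded
  by \<open>2 * l\<close>; in the final shrinking step it is bounded by \<open>d\<close>, hence by
  \<open>n\<close>.\<close>

lemma fd_sketch_cost:
  assumes R: "valid_svd_routine c R" and A: "A \<in> carrier_mat n d" and l: "1 \<le> l" and d: "1 \<le> d" "d \<le> n"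
  shows "real (time (fd_sketch R l d (rows A))) \<le> (6 * max c 0 + 46) * (real n * real d * real l)"
    and "real (mem (fd_sketch R l d (rows A))) \<le> (2 * max c 0 + 22) * (real d * real l)"
proof -
  have svd: "\<And>M. is_svd M (svd R M)" using R by (simp add: valid_svd_routine_def)
  have as: "set (rows A) \<subseteq> carrier_vec d" using A by (auto simp: rows_def)
  note fd = fd_sketch_correct[OF svd l as]
  define S where "S = real (shrink_time R l d)"
  define K where "K = 2 * max c 0 + 12"
  define X where "X = real n * real d * real l"
  define T where "T = real (time (fd_sketch R l d (rows A)))"
  have K: "0 \<le> K" by (simp add: K_def)
  have ln: "length (rows A) = n" using A by simp
  have S: "S \<le> K * (real l * real d * real (min (2 * l) d))"
    using shrink_time_le[OF R l d(1)] by (simp add: S_def K_def)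
  have "S \<le> K * (real l * real d * (2 * real l))"
    by (rule order_trans[OF S]) (use K in \<open>auto intro!: mult_left_mono\<close>)
  then have "real n * S \<le> real n * (K * (real l * real d * (2 * real l)))"
    by (rule mult_left_mono) simp
  also have "\<dots> = real l * (2 * K * X)" by (simp add: X_def)
  finally have nS: "real n * S \<le> real l * (2 * K * X)" .
  have "S \<le> K * (real l * real d * real n)"
    by (rule order_trans[OF S]) (use K d in \<open>auto intro!: mult_left_mono\<close>)
  then have "real l * S \<le> real l * (K * (real l * real d * real n))"
    by (rule mult_left_mono) simp
  also have "\<dots> = real l * (K * X)" by (simp add: X_def)
  finally have lS: "real l * S \<le> real l * (K * X)" .
  have "l * d \<le> n * (l * d)" "d \<le> l * d" using l d by auto
  then have "l * (3 * l * d) + n * (l * (6 * l * d + d)) \<le> l * (10 * (n * d * l))"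
  proof -
    have "n * d \<le> n * (l * d)" using \<open>d \<le> l * d\<close> by (rule mult_le_mono2)
    moreover have "n * (6 * l * d + d) = 6 * (n * (l * d)) + n * d" "10 * (n * d * l) = 10 * (n * (l * d))"
      "3 * l * d = 3 * (l * d)"
      by (simp_all add: algebra_simps)
    ultimately have "3 * l * d + n * (6 * l * d + d) \<le> 10 * (n * d * l)"
      using \<open>l * d \<le> n * (l * d)\<close> by linarith
    then have "l * (3 * l * d + n * (6 * l * d + d)) \<le> l * (10 * (n * d * l))"
      by (rule mult_le_mono2)
    then show ?thesis by (simp add: algebra_simps)
  qed
  then have "l * time (fd_sketch R l d (rows A)) \<le> l * (10 * (n * d * l)) + (n + l) * shrink_time R l d"
    using fd(4) unfolding ln by linarith
  then have "real (l * time (fd_sketch R l d (rows A))) \<le>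
      real (l * (10 * (n * d * l)) + (n + l) * shrink_time R l d)"
    by (rule of_nat_mono)
  then have "real l * T \<le> real l * (10 * X) + real n * S + real l * S"
    by (simp add: T_def X_def S_def algebra_simps)
  also have "\<dots> \<le> real l * ((10 + 3 * K) * X)"
    using nS lS by (simp add: algebra_simps)
  finally have "T \<le> (10 + 3 * K) * X" using l by simp
  then show "real (time (fd_sketch R l d (rows A))) \<le> (6 * max c 0 + 46) * (real n * real d * real l)"
    by (simp add: T_def X_def K_def algebra_simps)
  have "d \<le> d * l" using l by simp
  then have "8 * l * d + d \<le> 9 * (d * l)" by (simp add: ac_simps)
  then have "real (8 * l * d + d) \<le> real (9 * (d * l))" by (rule of_nat_mono)
  moreover have "real (mem (fd_sketch R l d (rows A))) \<le> real (8 * l * d + d) + real (shrink_mem R l d)"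
    using of_nat_mono[OF fd(5), where 'a = real] by simp
  ultimately show "real (mem (fd_sketch R l d (rows A))) \<le> (2 * max c 0 + 22) * (real d * real l)"
    using shrink_mem_le[OF R l d(1)] by (simp add: algebra_simps)
qed

section \<open>The complete algorithm\<close>

context
  fixes R :: svd_routine and c :: real and A :: "real mat" and n d k l :: nat and Q W :: "real mat" and s :: "real vec"
  assumes R: "valid_svd_routine c R" and A: "A \<in> carrier_mat n d"
    and kl: "1 \<le> k" "k \<le> l" "k \<le> d" "d \<le> n"
    and svd_At: "svd R (res (fd_sketch R l d (rows A))) = (Q, s, W)"
begin

private abbreviation (input) "At \<equiv> res (fd_sketch R l d (rows A))"

lemma sketch_carrier: "At \<in> carrier_mat l d"
proof -
  have "\<And>M. is_svd M (svd R M)" using R by (simp add: valid_svd_routine_def)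
  moreover have "set (rows A) \<subseteq> carrier_vec d" using A by (auto simp: rows_def)
  ultimately show ?thesis using fd_sketch_correct(1) kl by simp
qed

lemma sketch_svd: "is_svd At (Q, s, W)"
  using R svd_At unfolding valid_svd_routine_def by metis

lemma sketch_right_factor: "W \<in> carrier_mat d (min l d)"
  using svd_carrier(3)[OF sketch_svd] sketch_carrier by auto

lemma res_first_pass:
  "res (first_pass R l k d (rows A)) = (vec k (entry0 s), mat d k (\<lambda>(i, j). W $$ (i, j)))"
  using sketch_carrier by (simp add: first_pass_def res_bind_comp res_top_svd[OF svd_At sketch_svd])

lemma res_two_pass:
  "res (two_pass R l k d (rows A)) = map (\<lambda>a.
    (ip d (\<lambda>t. a $ t) (\<lambda>t. a $ t) - (\<Sum>j<k. (ip d (\<lambda>t. a $ t) (col_fun W j))\<^sup>2),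
     \<Sum>j<k. (ip d (\<lambda>t. a $ t) (col_fun W j))\<^sup>2 / (entry0 s j)\<^sup>2)) (rows A)"
  unfolding two_pass_def res_bind_comp res_first_pass prod.case res_stream_emit
  by (rule map_cong[OF refl], rule res_row_scores_eq[OF _ sketch_right_factor])
    (use A kl in \<open>auto simp: rows_def\<close>)

private abbreviation (input) "emit \<equiv>
  stream_emit (row_scores (vec k (entry0 s)) (mat d k (\<lambda>(i, j). W $$ (i, j)))) (rows A)"

lemma emit_cost:
  "real (time emit) \<le> 14 * (real n * real d * real l)"
  "real (mem emit) \<le> 10 * (real d * real l)"
proof -
  have rows: "a \<in> carrier_vec d" if "a \<in> set (rows A)" for a using A that by (auto simp: rows_def)
  have "k * k \<le> d * l" "d * k \<le> d * l" using kl by (auto intro: mult_le_mono)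
  moreover have "d \<le> d * l" "1 \<le> d * l" using kl by auto
  moreover have "k \<le> d * l" using kl \<open>d \<le> d * l\<close> by linarith
  ultimately have t: "d + (5 * d * k + 3 * k * k + 2 * k + 3 * d) \<le> 14 * (d * l)"
    and m: "d + (d * k + 2 * k + k * k + 2 * d + 2) \<le> 10 * (d * l)"
    unfolding mult.assoc by linarith+
  have "time emit \<le> length (rows A) * (14 * (d * l))"
  proof (rule time_stream_emit)
    fix a assume "a \<in> set (rows A)"
    then have "a \<in> carrier_vec d" by (rule rows)
    then show "dim_vec a + time (row_scores (vec k (entry0 s)) (mat d k (\<lambda>(i, j). W $$ (i, j))) a) \<le> 14 * (d * l)"
      using time_row_scores[of a d "vec k (entry0 s)" k "mat d k (\<lambda>(i, j). W $$ (i, j))"] t by simp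
  qed
  then have "time emit \<le> 14 * (n * d * l)" using A by (simp add: ac_simps)
  from of_nat_mono[OF this, where 'a = real]
  show "real (time emit) \<le> 14 * (real n * real d * real l)" by simp
  have "mem emit \<le> 10 * (d * l)"
  proof (rule mem_stream_emit)
    fix a assume "a \<in> set (rows A)"
    then have "a \<in> carrier_vec d" by (rule rows)
    then show "dim_vec a + mem (row_scores (vec k (entry0 s)) (mat d k (\<lambda>(i, j). W $$ (i, j))) a) \<le> 10 * (d * l)"
      using mem_row_scores[of a d "vec k (entry0 s)" k "mat d k (\<lambda>(i, j). W $$ (i, j))"] m by simp
  qed
  from of_nat_mono[OF this, where 'a = real]
  show "real (mem emit) \<le> 10 * (real d * real l)" by simp
qed

lemma top_svd_cost:
  "real (time (top_svd R k At)) \<le> (max c 0 + 2) * (real n * real d * real l)"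
  "real (mem (top_svd R k At)) \<le> (max c 0 + 5) * (real d * real l)"
proof -
  have dims: "dim_row At = l" "dim_col At = d" "dim_vec s = min l d"
    using sketch_carrier svd_carrier(2)[OF sketch_svd] by auto
  have "k \<le> n * d * l" "d * k \<le> n * d * l"
  proof -
    have "d * k \<le> d * l" using kl by simp
    also have "\<dots> \<le> n * (d * l)" using kl by simp
    finally show "d * k \<le> n * d * l" by (simp add: mult.assoc)
    moreover have "k \<le> d * k" using kl by simp
    ultimately show "k \<le> n * d * l" by linarith
  qed
  then have "k + d * k \<le> 2 * (n * d * l)" by linarith
  from of_nat_mono[OF this, where 'a = real]
  have 1: "real (k + d * k) \<le> 2 * (real n * real d * real l)" by simp
  have "real (svd_time R l d) \<le> c * real l * real d * real (min l d)"
    using R by (simp add: valid_svd_routine_def)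
  also have "\<dots> = c * (real l * real d * real (min l d))" by simp
  also have "\<dots> \<le> max c 0 * (real l * real d * real n)"
    using kl by (intro mult_mono) auto
  finally have "real (svd_time R l d) \<le> max c 0 * (real n * real d * real l)" by (simp add: ac_simps)
  then show "real (time (top_svd R k At)) \<le> (max c 0 + 2) * (real n * real d * real l)"
    using 1 by (simp add: time_top_svd[OF svd_At sketch_svd] dims algebra_simps)
  have "real (svd_work R l d) \<le> c * real l * real d"
    using R by (simp add: valid_svd_routine_def)
  also have "\<dots> = c * (real d * real l)" by simp
  also have "\<dots> \<le> max c 0 * (real d * real l)" by (intro mult_right_mono) auto
  finally have 2: "real (svd_work R l d) \<le> max c 0 * (real d * real l)" .
  have "l * min l d \<le> d * l" "d * min l d \<le> d * l" "d * k \<le> d * l" using kl by auto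
  moreover have "min l d \<le> d * l" "k \<le> d * l" using kl by (auto simp: min_def intro: order_trans[of _ l])
  ultimately have "l * min l d + min l d + d * min l d + k + d * k \<le> 5 * (d * l)" by linarith
  from of_nat_mono[OF this, where 'a = real]
  have "real (l * min l d + min l d + d * min l d + k + d * k) \<le> 5 * (real d * real l)" by simp
  moreover have "real (mem (top_svd R k At)) \<le>
      real (svd_work R l d) + real (l * min l d + min l d + d * min l d + k + d * k)"
    using of_nat_mono[OF mem_top_svd[OF svd_At sketch_svd, of k], where 'a = real] dims by simp
  ultimately show "real (mem (top_svd R k At)) \<le> (max c 0 + 5) * (real d * real l)"
    using 2 by (simp add: algebra_simps)
qed

text \<open>The peak memory is at most the sum over the parts, each of order \<open>d * l\<close>.
  The common constant leaves room: the times add up to \<open>7 * max c 0 + 62\<close>, the memory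
  to \<open>3 * max c 0 + 39\<close>.\<close>

lemma two_pass_cost:
  "real (mem (two_pass R l k d (rows A))) \<le> (7 * max c 0 + 100) * real d * real l"
  "real (time (two_pass R l k d (rows A))) \<le> (7 * max c 0 + 100) * real n * real d * real l"
proof -
  have fd: "real (time (fd_sketch R l d (rows A))) \<le> (6 * max c 0 + 46) * (real n * real d * real l)"
    "real (mem (fd_sketch R l d (rows A))) \<le> (2 * max c 0 + 22) * (real d * real l)"
    using fd_sketch_cost[OF R A] kl by auto
  have "time (two_pass R l k d (rows A)) =
      time (fd_sketch R l d (rows A)) + time (top_svd R k At) + time emit"
    by (simp add: two_pass_def time_bind_comp res_first_pass) (simp add: first_pass_def time_bind_comp)
  moreover have "0 \<le> real n * real d * real l" by simp
  ultimately show "real (time (two_pass R l k d (rows A))) \<le> (7 * max c 0 + 100) * real n * real d * real l"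
    using fd(1) top_svd_cost(1) emit_cost(1) by (simp add: algebra_simps)
  have "k \<le> d * l" "d * k \<le> d * l" using kl by (auto intro: order_trans[of _ l])
  then have m: "k + d * k \<le> 2 * (d * l)" by linarith
  have "0 + mem (two_pass R l k d (rows A)) \<le>
      mem (fd_sketch R l d (rows A)) + 2 * (d * l) + mem (top_svd R k At) + mem emit"
    unfolding two_pass_def
  proof (rule mem_bind_comp_leI)
    show "0 + mem (first_pass R l k d (rows A)) \<le>
        mem (fd_sketch R l d (rows A)) + 2 * (d * l) + mem (top_svd R k At) + mem emit"
      unfolding first_pass_def
      by (rule mem_bind_comp_leI) (use sketch_carrier in \<open>simp_all add: reals_stored_simps\<close>)
    show "0 + reals_stored (res (first_pass R l k d (rows A))) +
        mem (case res (first_pass R l k d (rows A)) of (\<sigma>k, Vk) \<Rightarrow> stream_emit (row_scores \<sigma>k Vk) (rows A)) \<le>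
        mem (fd_sketch R l d (rows A)) + 2 * (d * l) + mem (top_svd R k At) + mem emit"
      unfolding res_first_pass prod.case using m by (simp add: reals_stored_simps)
  qed
  then have "mem (two_pass R l k d (rows A)) \<le>
      mem (fd_sketch R l d (rows A)) + 2 * (d * l) + mem (top_svd R k At) + mem emit" by simp
  from of_nat_mono[OF this, where 'a = real]
  have "real (mem (two_pass R l k d (rows A))) \<le> real (mem (fd_sketch R l d (rows A)))
      + 2 * (real d * real l) + real (mem (top_svd R k At)) + real (mem emit)" by simp
  moreover have "0 \<le> real d * real l" "0 \<le> max c 0 * (real d * real l)" by simp_all
  ultimately show "real (mem (two_pass R l k d (rows A))) \<le> (7 * max c 0 + 100) * real d * real l"
    using fd(2) top_svd_cost(2) emit_cost(2) by (simp add: algebra_simps)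
qed

text \<open>The perturbation bounds are instantiated with squared singular values. Positivity of the
  first \<open>k\<close> sketch values is included because it makes the divisions in the second pass
  genuine.\<close>

lemma two_pass_accuracy:
  fixes \<epsilon> \<Delta> :: real
  assumes svd_A: "is_svd A (U, \<sigma>, V)" and pos: "\<forall>j<d. 0 < entry0 \<sigma> j"
    and k: "k < d" and \<Delta>: "0 < \<Delta>" and \<epsilon>: "0 < \<epsilon>"
    and sep: "separated k \<Delta> \<sigma>" and rank: "approx_rank k d \<sigma>"
    and l: "20 * real k \<le> \<Delta> * real l"
      "160000 * (real k * cond_number k \<sigma>)\<^sup>2 \<le> (\<epsilon> * \<Delta>)\<^sup>2 * real l"
  shows "\<And>j. j < k \<Longrightarrow> 0 < entry0 s j"
    and "\<And>i. i < n \<Longrightarrow> \<bar>projection_distance k V (row A i) - fst (res (two_pass R l k d (rows A)) ! i)\<bar>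
           \<le> \<epsilon> * sq_norm2 (row A i)"
    and "\<And>i. i < n \<Longrightarrow> \<bar>leverage_score k \<sigma> V (row A i) - snd (res (two_pass R l k d (rows A)) ! i)\<bar>
           \<le> \<epsilon> * real k * sq_norm2 (row A i) / sq_frobenius A"
proof -
  define \<alpha> where "\<alpha> i = (entry0 \<sigma> i)\<^sup>2" for i
  define \<beta> where "\<beta> j = (entry0 s j)\<^sup>2" for j
  define r where "r = min l d"
  have dimA: "dim_row A = n" "dim_col A = d" and nd: "min n d = d" using A kl by auto
  have dimAt: "dim_row At = l" "dim_col At = d" using sketch_carrier by auto
  have dims: "dim_vec \<sigma> = d" "V \<in> carrier_mat d d" "dim_vec s = r"
    using svd_carrier[OF svd_A] svd_carrier(2)[OF sketch_svd] dimA dimAt nd by (auto simp: r_def)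
  have v: "orthonormal d d (col_fun V)"
    using svd_right_orthonormal[OF svd_A] dimA nd by simp
  have w: "orthonormal d r (col_fun W)"
    using svd_right_orthonormal[OF sketch_svd] dimAt by (simp add: r_def)
  have VV: "transpose_mat V * V = 1\<^sub>m d"
    using svd_A dimA nd by (simp add: is_svd_def Let_def)
  have complete: "\<forall>a. \<forall>t<d. a t = (\<Sum>i<d. ip d a (col_fun V i) * col_fun V i t)"
    using orthonormal_columns_complete[OF dims(2) VV] by blast
  have \<alpha>_antimono: "\<forall>j<d. \<forall>i\<le>j. \<alpha> j \<le> \<alpha> i"
    using svd_values_antimono[OF svd_A] svd_values_nonneg[OF svd_A] dims(1) dimA nd
    by (auto simp: \<alpha>_def entry0_def intro: power_mono)
  have \<beta>_antimono: "\<forall>j<r. \<forall>i\<le>j. \<beta> j \<le> \<beta> i"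
    using svd_values_antimono[OF sketch_svd] svd_values_nonneg[OF sketch_svd] dims(3) dimAt
    by (auto simp: \<beta>_def entry0_def r_def intro: power_mono)
  have gram_A: "gram_form A x = (\<Sum>i<d. \<alpha> i * (ip d x (col_fun V i))\<^sup>2)" for x
    unfolding svd_gram_form[OF svd_A] dimA nd
    by (rule sum.cong) (use dims in \<open>auto simp: \<alpha>_def entry0_def\<close>)
  have gram_At: "gram_form At x = (\<Sum>j<r. \<beta> j * (ip d x (col_fun W j))\<^sup>2)" for x
    unfolding svd_gram_form[OF sketch_svd] dimAt r_def[symmetric]
    by (rule sum.cong) (use dims in \<open>auto simp: \<beta>_def entry0_def\<close>)
  have frob: "sq_frobenius A = (\<Sum>i<d. \<alpha> i)"
    unfolding svd_sq_frobenius[OF svd_A] dimA nd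
    by (rule sum.cong) (use dims in \<open>auto simp: \<alpha>_def entry0_def\<close>)
  \<comment> \<open>The top \<open>k\<close> values sum to at most \<open>k * \<alpha> 0\<close>;
    the approximate rank turns this into a bound for the whole trace, with the factor 10.\<close>
  have "(\<Sum>j<k. \<alpha> j) \<le> (\<Sum>j<k. \<alpha> 0)"
    using \<alpha>_antimono k by (intro sum_mono) auto
  then have frob_le: "sq_frobenius A \<le> 10 * real k * \<alpha> 0"
    using rank by (simp add: approx_rank_def frob \<alpha>_def[symmetric])
  have svd: "\<And>M. is_svd M (svd R M)" using R by (simp add: valid_svd_routine_def)
  have as: "set (rows A) \<subseteq> carrier_vec d" using A by (auto simp: rows_def)
  have l1: "1 \<le> l" using kl by simp
  note fd = fd_sketch_correct[OF svd l1 as, unfolded sum_list_rows_form[OF A] sum_list_rows_sq_frobenius[OF A]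
    gram_A gram_At]
  have l2: "160000 * (real k * (\<alpha> 0 / \<alpha> (k - 1)))\<^sup>2 \<le> (\<epsilon> * \<Delta>)\<^sup>2 * real l"
    using l(2) by (simp add: cond_number_def \<alpha>_def)
  have \<alpha>0: "0 < \<alpha> 0" using pos[rule_format, of 0] k by (simp add: \<alpha>_def)
  have gap: "\<Delta> * \<alpha> 0 \<le> \<alpha> (k - 1) - \<alpha> k" using sep by (simp add: separated_def \<alpha>_def)
  have kr: "k \<le> r" using kl by (simp add: r_def)
  have "0 \<le> \<alpha> i" "0 \<le> \<beta> i" for i by (simp_all add: \<alpha>_def \<beta>_def)
  note scores = spectral_gap_scores[OF v complete w this(1) \<alpha>_antimono \<alpha>0 this(2) \<beta>_antimono kl(1) k kr
      \<Delta> \<epsilon> gap frob frob_le l1 l(1) l2 fd(2,3)]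
  show "0 < entry0 s j" if "j < k" for j
  proof -
    have "0 \<le> entry0 s j"
      using svd_values_nonneg[OF sketch_svd, of j] dims(3) dimAt by (auto simp: entry0_def r_def)
    moreover have "0 < \<beta> j" using scores(1)[OF that] by simp
    ultimately show ?thesis by (auto simp: \<beta>_def less_le)
  qed
  fix i assume i: "i < n"
  define a where "a = (\<lambda>t. row A i $ t)"
  have row: "row A i \<in> carrier_vec d" "dim_vec (row A i) = d" using A i by auto
  have norm: "sq_norm2 (row A i) = ip d a a"
    using row by (simp add: sq_norm2_def scalar_prod_def ip_def a_def atLeast0LessThan)
  have col: "row A i \<bullet> col V j = ip d a (col_fun V j)" if "j < d" for j
    using scalar_prod_col[OF row(1) dims(2) that] by (simp add: a_def)
  have res: "res (two_pass R l k d (rows A)) ! i =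
    (ip d a a - (\<Sum>j<k. (ip d a (col_fun W j))\<^sup>2), \<Sum>j<k. (ip d a (col_fun W j))\<^sup>2 / \<beta> j)"
    using A i by (simp add: res_two_pass a_def \<beta>_def)
  \<comment> \<open>Parseval turns the tail sum of the projection distance into the squared norm
    minus the top part. The squared norm cancels against the one in the computed score, so the error
    is that of the top part with the opposite sign.\<close>
  have "ip d a a = (\<Sum>j<d. (ip d a (col_fun V j))\<^sup>2)"
  proof -
    have "ip d a a = ip d (\<lambda>t. \<Sum>j<d. ip d a (col_fun V j) * V $$ (t, j)) (\<lambda>t. \<Sum>j<d. ip d a (col_fun V j) * V $$ (t, j))"
      unfolding ip_def[of d a a] ip_def[of d "\<lambda>t. \<Sum>j<d. ip d a (col_fun V j) * V $$ (t, j)"]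
      by (rule sum.cong) (use complete[rule_format, of _ a] in auto)
    then show ?thesis unfolding orthonormal_combination_norm[OF v] .
  qed
  also have "\<dots> = (\<Sum>j<k. (ip d a (col_fun V j))\<^sup>2) + (\<Sum>j = k..<d. (ip d a (col_fun V j))\<^sup>2)"
    using k by (simp add: atLeast0LessThan[symmetric] sum.atLeastLessThan_concat)
  finally have "projection_distance k V (row A i) = ip d a a - (\<Sum>j<k. (ip d a (col_fun V j))\<^sup>2)"
    using row by (simp add: projection_distance_def col)
  then show "\<bar>projection_distance k V (row A i) - fst (res (two_pass R l k d (rows A)) ! i)\<bar>
           \<le> \<epsilon> * sq_norm2 (row A i)"
    using scores(2)[of a] by (simp add: res norm abs_minus_commute)
  have "leverage_score k \<sigma> V (row A i) = (\<Sum>j<k. (ip d a (col_fun V j))\<^sup>2 / \<alpha> j)"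
    using k by (simp add: leverage_score_def col \<alpha>_def)
  then show "\<bar>leverage_score k \<sigma> V (row A i) - snd (res (two_pass R l k d (rows A)) ! i)\<bar>
           \<le> \<epsilon> * real k * sq_norm2 (row A i) / sq_frobenius A"
    using scores(3)[of a] by (simp add: res norm frob)
qed

end

section \<open>Choice of the sketch size and conclusion\<close>

lemma sketch_size_exists:
  fixes \<epsilon> \<Delta> \<kappa> :: real
  assumes "1 \<le> k" "0 < \<epsilon>" "0 < \<Delta>"
  obtains l :: nat where "k \<le> l" "20 * real k \<le> \<Delta> * real l"
    "160000 * (real k * \<kappa>)\<^sup>2 \<le> (\<epsilon> * \<Delta>)\<^sup>2 * real l"
    "real l \<le> (real k)\<^sup>2 * (160000 * (1 / \<epsilon>)\<^sup>2 * \<kappa>\<^sup>2 * (1 / \<Delta>)\<^sup>2 + 20 * (1 / \<Delta>) + 2)"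
proof -
  define x where "x = 160000 * (1 / \<epsilon>)\<^sup>2 * \<kappa>\<^sup>2 * (1 / \<Delta>)\<^sup>2"
  \<comment> \<open>Here \<open>x\<close> serves the accuracy, \<open>20 / \<Delta>\<close> the gap,
    and the 1 ensures \<open>k \<le> l\<close>. Rounding up costs at most 1, which
    \<open>k^2\<close> absorbs into the final constant 2.\<close>
  define l where "l = nat \<lceil>(real k)\<^sup>2 * (x + 20 * (1 / \<Delta>) + 1)\<rceil>"
  have x: "0 \<le> x" by (simp add: x_def)
  have k: "real k \<le> (real k)\<^sup>2" "1 \<le> (real k)\<^sup>2"
    using assms(1) self_le_power[of "real k" 2] one_le_power[of "real k" 2] by auto
  have "0 \<le> (real k)\<^sup>2 * (x + 20 * (1 / \<Delta>) + 1)" using x assms by simp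
  then have lo: "(real k)\<^sup>2 * (x + 20 * (1 / \<Delta>) + 1) \<le> real l"
    and hi: "real l \<le> (real k)\<^sup>2 * (x + 20 * (1 / \<Delta>) + 1) + 1"
    by (auto simp: l_def)
  show ?thesis
  proof
    have "real k \<le> (real k)\<^sup>2 * 1" using k by simp
    also have "\<dots> \<le> (real k)\<^sup>2 * (x + 20 * (1 / \<Delta>) + 1)" using x assms by (intro mult_left_mono) auto
    finally have "real k \<le> real l" using lo by simp
    then show "k \<le> l" by simp
    have "20 * real k \<le> \<Delta> * ((real k)\<^sup>2 * (20 * (1 / \<Delta>)))" using k assms by simp
    also have "\<dots> \<le> \<Delta> * ((real k)\<^sup>2 * (x + 20 * (1 / \<Delta>) + 1))"
      using x assms by (intro mult_left_mono) auto
    also have "\<dots> \<le> \<Delta> * real l" using lo assms by (intro mult_left_mono) auto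
    finally show "20 * real k \<le> \<Delta> * real l" .
    have "160000 * (real k * \<kappa>)\<^sup>2 = (\<epsilon> * \<Delta>)\<^sup>2 * ((real k)\<^sup>2 * x)"
      using assms by (simp add: x_def power_mult_distrib power_divide)
    also have "\<dots> \<le> (\<epsilon> * \<Delta>)\<^sup>2 * ((real k)\<^sup>2 * (x + 20 * (1 / \<Delta>) + 1))"
      using assms by (intro mult_left_mono) auto
    also have "\<dots> \<le> (\<epsilon> * \<Delta>)\<^sup>2 * real l" using lo by (intro mult_left_mono) auto
    finally show "160000 * (real k * \<kappa>)\<^sup>2 \<le> (\<epsilon> * \<Delta>)\<^sup>2 * real l" .
    have "real l \<le> (real k)\<^sup>2 * (x + 20 * (1 / \<Delta>) + 2)"
      using hi k by (simp add: algebra_simps)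
    then show "real l \<le> (real k)\<^sup>2 * (160000 * (1 / \<epsilon>)\<^sup>2 * \<kappa>\<^sup>2 * (1 / \<Delta>)\<^sup>2 + 20 * (1 / \<Delta>) + 2)"
      by (simp add: x_def)
  qed
qed

definition size_coeff :: "nat \<Rightarrow> nat \<Rightarrow> nat \<Rightarrow> real" where
  "size_coeff a b c =
    (if a = 2 \<and> b = 2 \<and> c = 2 then 160000 else if a = 0 \<and> b = 0 \<and> c = 1 then 20
     else if a = 0 \<and> b = 0 \<and> c = 0 then 2 else 0)"

lemma poly3_size_coeff: "poly3 2 size_coeff x y z = 160000 * x\<^sup>2 * y\<^sup>2 * z\<^sup>2 + 20 * z + 2"
  by (simp add: poly3_def size_coeff_def numeral_2_eq_2)

theorem theorem1:
  "\<exists>(N::nat) (p::nat \<Rightarrow> nat \<Rightarrow> nat \<Rightarrow> real). (\<forall>a b c. 0 \<le> p a b c) \<and>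
    (\<forall>c::real. \<exists>C::real. \<forall>(n::nat) (d::nat) (k::nat) (A::real mat) (U::real mat) (\<sigma>::real vec)
        (V::real mat) (\<Delta>::real) (\<epsilon>::real).
      A \<in> carrier_mat n d \<longrightarrow> is_svd A (U, \<sigma>, V) \<longrightarrow> (\<forall>j<d. 0 < entry0 \<sigma> j) \<longrightarrow>
      1 \<le> k \<longrightarrow> k < d \<longrightarrow> 0 < \<Delta> \<longrightarrow> separated k \<Delta> \<sigma> \<longrightarrow> approx_rank k d \<sigma> \<longrightarrow> 0 < \<epsilon> \<longrightarrow>
      (\<exists>l::nat. 1 \<le> l \<and>
        real l \<le> (real k)\<^sup>2 * poly3 N p (1 / \<epsilon>) (cond_number k \<sigma>) (1 / \<Delta>) \<and>
        (\<forall>R. valid_svd_routine c R \<longrightarrow>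
          (let run = two_pass R l k d (rows A);
               \<sigma>k = fst (res (first_pass R l k d (rows A)))
           in (\<forall>j<k. 0 < \<sigma>k $ j) \<and>
              (\<forall>i<n.
                \<bar>projection_distance k V (row A i) - fst (res run ! i)\<bar>
                  \<le> \<epsilon> * sq_norm2 (row A i) \<and>
                \<bar>leverage_score k \<sigma> V (row A i) - snd (res run ! i)\<bar>
                  \<le> \<epsilon> * real k * sq_norm2 (row A i) / sq_frobenius A) \<and>
              real (mem run) \<le> C * real d * real l \<and>
              real (time run) \<le> C * real n * real d * real l))))"
proof -
  \<comment> \<open>The size \<open>l\<close> is fixed before the SVD routine and serves all of
    them; the cost constant depends on \<open>c\<close> alone.\<close>
  have main: "\<exists>l::nat. 1 \<le> l \<and>
        real l \<le> (real k)\<^sup>2 * poly3 2 size_coeff (1 / \<epsilon>) (cond_number k \<sigma>) (1 / \<Delta>) \<and>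
        (\<forall>R. valid_svd_routine c R \<longrightarrow>
          (let run = two_pass R l k d (rows A);
               \<sigma>k = fst (res (first_pass R l k d (rows A)))
           in (\<forall>j<k. 0 < \<sigma>k $ j) \<and>
              (\<forall>i<n.
                \<bar>projection_distance k V (row A i) - fst (res run ! i)\<bar>
                  \<le> \<epsilon> * sq_norm2 (row A i) \<and>
                \<bar>leverage_score k \<sigma> V (row A i) - snd (res run ! i)\<bar>
                  \<le> \<epsilon> * real k * sq_norm2 (row A i) / sq_frobenius A) \<and>
              real (mem run) \<le> (7 * max c 0 + 100) * real d * real l \<and>
              real (time run) \<le> (7 * max c 0 + 100) * real n * real d * real l))"
    if A: "A \<in> carrier_mat n d" and svd_A: "is_svd A (U, \<sigma>, V)" and pos: "\<forall>j<d. 0 < entry0 \<sigma> j"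
      and k: "1 \<le> k" "k < d" and \<Delta>: "0 < \<Delta>" and sep: "separated k \<Delta> \<sigma>" and rank: "approx_rank k d \<sigma>"
      and \<epsilon>: "0 < \<epsilon>"
    for c n d k A U \<sigma> V and \<Delta> \<epsilon> :: real
  proof -
    obtain l where l: "k \<le> l" "20 * real k \<le> \<Delta> * real l"
      "160000 * (real k * cond_number k \<sigma>)\<^sup>2 \<le> (\<epsilon> * \<Delta>)\<^sup>2 * real l"
      "real l \<le> (real k)\<^sup>2 * (160000 * (1 / \<epsilon>)\<^sup>2 * (cond_number k \<sigma>)\<^sup>2 * (1 / \<Delta>)\<^sup>2 + 20 * (1 / \<Delta>) + 2)"
      using sketch_size_exists[OF k(1) \<epsilon> \<Delta>] by blast
    \<comment> \<open>A positive value at index \<open>d - 1\<close> cannot be padding, so there are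
      \<open>d\<close> singular values and at least \<open>d\<close> rows.\<close>
    have dn: "d \<le> n"
    proof -
      have "0 < entry0 \<sigma> (d - 1)" using pos k by simp
      then have "d - 1 < dim_vec \<sigma>" by (auto simp: entry0_def split: if_splits)
      then show ?thesis using svd_carrier(2)[OF svd_A] A k by auto
    qed
    have kd: "k \<le> d" using k by simp
    have "(let run = two_pass R l k d (rows A);
               \<sigma>k = fst (res (first_pass R l k d (rows A)))
           in (\<forall>j<k. 0 < \<sigma>k $ j) \<and>
              (\<forall>i<n.
                \<bar>projection_distance k V (row A i) - fst (res run ! i)\<bar>
                  \<le> \<epsilon> * sq_norm2 (row A i) \<and>
                \<bar>leverage_score k \<sigma> V (row A i) - snd (res run ! i)\<bar>
                  \<le> \<epsilon> * real k * sq_norm2 (row A i) / sq_frobenius A) \<and>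
              real (mem run) \<le> (7 * max c 0 + 100) * real d * real l \<and>
              real (time run) \<le> (7 * max c 0 + 100) * real n * real d * real l)"
      if R: "valid_svd_routine c R" for R
    proof -
      obtain Q s W where svd_At: "svd R (res (fd_sketch R l d (rows A))) = (Q, s, W)"
        by (cases "svd R (res (fd_sketch R l d (rows A)))") auto
      note ctxt = R A k(1) l(1) kd dn svd_At
      note accuracy = two_pass_accuracy[OF ctxt svd_A pos k(2) \<Delta> \<epsilon> sep rank l(2,3)]
      show ?thesis
        unfolding Let_def res_first_pass[OF ctxt] fst_conv
        by (intro conjI allI impI two_pass_cost[OF ctxt] accuracy(2,3)) (simp_all add: accuracy(1))
    qed
    then show ?thesis
      using l(1,4) k(1) by (intro exI[of _ l]) (auto simp: poly3_size_coeff)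
  qed
  show ?thesis
    apply (rule exI[of _ 2], rule exI[of _ size_coeff], intro conjI allI)
    subgoal by (simp add: size_coeff_def)
    subgoal for c
      by (rule exI[of _ "7 * max c 0 + 100"], intro allI impI, rule main)
    done
qed

end
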